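(* Let $X$ be a Hausdorff space, let $G$ be a finite germ extension of some $B\leq\mathrm{Homeo}(X)$, and suppose that $B$ has no global fixed points in $X$ and that $B$ and $G$ have the same orbits in $X$. Then there is an exact sequence \[ B/B'\longrightarrow G/G'\longrightarrow \bigoplus_{p\in R}A_p(G)\longrightarrow 0, \] where the first map is induced by the inclusion $B\leq G$ and $R$ is a system of representatives for the $B$-orbits in $X$. In particular, if $B$ is perfect then $G/G'\cong\bigoplus_{p\in R}A_p(G)$.
   Context: Finite germ extensions. Let $X$ be a Hausdorff space and $B\leq\mathrm{Homeo}(X)$ a group of homeomorphisms of $X$ (the base group). For $h\in\mathrm{Homeo}(X)$, $\mathrm{sing}(h)$ is the set of points $p\in X$ such that $h$ does not agree with any element of $B$ on any neighborhood of $p$. A group $G\leq\mathrm{Homeo}(X)$ is a finite germ extension of $B$ if: (i) $\mathrm{sing}(g)$ is finite for every $g\in G$; (ii) $B\leq G$, and $B$ is precisely the set of $g\in G$ with $\mathrm{sing}(g)=\emptyset$; (iii) for every $g\in G$ and $p\in\mathrm{sing}(g)$ there is an $h\in G$ with $\mathrm{sing}(h)=\{p\}$ such that $h$ agrees with $g$ on some neighborhood of $p$. Germs. For $p\in X$, $(G)_p=\mathrm{Stab}_G(p)/\mathrm{RStab}_G(p)$, where $\mathrm{RStab}_G(p)$ is the subgroup of $\mathrm{Stab}_G(p)$ of elements that are the identity in a neighborhood of $p$. $(B)_p$ is defined in the same way from $B$ and is regarded as a subgroup of $(G)_p$. For $p\in X$, $A_p(G)$ is the abelian group fitting into the exact sequence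 $(B)_p/(B)_p'\to(G)_p/(G)_p'\to A_p(G)\to 0$, where the first map is induced by inclusion; that is, $A_p(G)=(G)_p/\bigl((G)_p'(B)_p\bigr)$. Here $H'$ denotes the commutator subgroup of a group $H$. *)

theory Defs
  imports "HOL-Analysis.T1_Spaces" "HOL-Algebra.Group_Action" "HOL-Algebra.Exact_Sequence"
    "HOL-Algebra.Product_Groups"
begin

section \<open>Abelianization, perfect groups, exactness\<close>

abbreviation commutator_subgroup :: "('a, 'b) monoid_scheme \<Rightarrow> 'a set" where
  "commutator_subgroup K \<equiv> derived K (carrier K)"

abbreviation abelianization :: "('a, 'b) monoid_scheme \<Rightarrow> 'a set monoid" where
  "abelianization K \<equiv> K Mod commutator_subgroup K"

definition perfect_group :: "('a, 'b) monoid_scheme \<Rightarrow> bool" where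
  "perfect_group K \<longleftrightarrow> commutator_subgroup K = carrier K"

text \<open>Exactness of \<open>K \<rightarrow> L \<rightarrow> M \<rightarrow> 0\<close>. The library's \<^const>\<open>exact_seq\<close> requires all groups to have
  the same element type.\<close>

definition right_exact ::
    "('a, 'd) monoid_scheme \<Rightarrow> ('a \<Rightarrow> 'b) \<Rightarrow> ('b, 'e) monoid_scheme \<Rightarrow> ('b \<Rightarrow> 'c) \<Rightarrow>
     ('c, 'f) monoid_scheme \<Rightarrow> bool" where
  "right_exact K f L g M \<longleftrightarrow>
     group_hom K L f \<and> group_hom L M g \<and>
     kernel L M g = f ` carrier K \<and> g ` carrier L = carrier M"


section \<open>Groups of homeomorphisms\<close>

text \<open>As in \<^const>\<open>BijGroup\<close>, a self-homeomorphism of \<open>X\<close> is represented by a function that is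
  \<^const>\<open>undefined\<close> outside \<open>topspace X\<close>; the product is composition, acting from the left.\<close>

definition homeo_group :: "'a topology \<Rightarrow> ('a \<Rightarrow> 'a) monoid" where
  "homeo_group X =
     (BijGroup (topspace X))\<lparr>carrier := {f \<in> Bij (topspace X). homeomorphic_map X X f}\<rparr>"

abbreviation homeo_subgroup :: "'a topology \<Rightarrow> ('a \<Rightarrow> 'a) set \<Rightarrow> ('a \<Rightarrow> 'a) monoid" where
  "homeo_subgroup X H \<equiv> (homeo_group X)\<lparr>carrier := H\<rparr>"

definition agree_near :: "'a topology \<Rightarrow> 'a \<Rightarrow> ('a \<Rightarrow> 'a) \<Rightarrow> ('a \<Rightarrow> 'a) \<Rightarrow> bool" where
  "agree_near X p f g \<longleftrightarrow> (\<exists>U. openin X U \<and> p \<in> U \<and> (\<forall>x\<in>U. f x = g x))"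

definition has_global_fixed_point :: "'a topology \<Rightarrow> ('a \<Rightarrow> 'a) set \<Rightarrow> bool" where
  "has_global_fixed_point X H \<longleftrightarrow> (\<exists>p\<in>topspace X. \<forall>h\<in>H. h p = p)"

abbreviation homeo_orbits :: "'a topology \<Rightarrow> ('a \<Rightarrow> 'a) set \<Rightarrow> 'a set set" where
  "homeo_orbits X H \<equiv> orbits (homeo_subgroup X H) (topspace X) (\<lambda>h. h)"

definition orbit_representatives :: "'a topology \<Rightarrow> ('a \<Rightarrow> 'a) set \<Rightarrow> 'a set \<Rightarrow> bool" where
  "orbit_representatives X H R \<longleftrightarrow>
     R \<subseteq> topspace X \<and> (\<forall>Q\<in>homeo_orbits X H. \<exists>!p. p \<in> R \<and> p \<in> Q)"


section \<open>Finite germ extensions\<close>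

definition sing :: "'a topology \<Rightarrow> ('a \<Rightarrow> 'a) set \<Rightarrow> ('a \<Rightarrow> 'a) \<Rightarrow> 'a set" where
  "sing X B h = {p \<in> topspace X. \<not> (\<exists>b\<in>B. agree_near X p h b)}"

definition finite_germ_extension ::
    "'a topology \<Rightarrow> ('a \<Rightarrow> 'a) set \<Rightarrow> ('a \<Rightarrow> 'a) set \<Rightarrow> bool" where
  "finite_germ_extension X B G \<longleftrightarrow>
     subgroup B (homeo_group X) \<and> subgroup G (homeo_group X) \<and>
     (\<forall>g\<in>G. finite (sing X B g)) \<and>
     B \<subseteq> G \<and> B = {g \<in> G. sing X B g = {}} \<and>
     (\<forall>g\<in>G. \<forall>p\<in>sing X B g. \<exists>h\<in>G. sing X B h = {p} \<and> agree_near X p h g)"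


section \<open>Groups of germs\<close>

definition Stab :: "'a topology \<Rightarrow> ('a \<Rightarrow> 'a) set \<Rightarrow> 'a \<Rightarrow> ('a \<Rightarrow> 'a) set" where
  "Stab X H p = stabilizer (homeo_subgroup X H) (\<lambda>h. h) p"

definition RStab :: "'a topology \<Rightarrow> ('a \<Rightarrow> 'a) set \<Rightarrow> 'a \<Rightarrow> ('a \<Rightarrow> 'a) set" where
  "RStab X H p = {h \<in> Stab X H p. agree_near X p h (\<lambda>x. x)}"

definition germ_group :: "'a topology \<Rightarrow> ('a \<Rightarrow> 'a) set \<Rightarrow> 'a \<Rightarrow> ('a \<Rightarrow> 'a) set monoid" where
  "germ_group X H p = homeo_subgroup X (Stab X H p) Mod RStab X H p"

text \<open>The image of \<^term>\<open>germ_group X B p\<close> in \<^term>\<open>germ_group X G p\<close> for \<open>B \<subseteq> G\<close>: a coset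
  \<open>C\<close> of \<^term>\<open>RStab X B p\<close> is sent to the coset of \<^term>\<open>RStab X G p\<close> containing it. This is
  injective since \<^term>\<open>RStab X B p\<close> is the intersection of \<open>B\<close> with \<^term>\<open>RStab X G p\<close>.\<close>

definition germ_subgroup ::
    "'a topology \<Rightarrow> ('a \<Rightarrow> 'a) set \<Rightarrow> ('a \<Rightarrow> 'a) set \<Rightarrow> 'a \<Rightarrow> ('a \<Rightarrow> 'a) set set" where
  "germ_subgroup X B G p =
     (\<lambda>C. RStab X G p <#>\<^bsub>homeo_group X\<^esub> C) ` carrier (germ_group X B p)"

definition germ_abelian_quotient ::
    "'a topology \<Rightarrow> ('a \<Rightarrow> 'a) set \<Rightarrow> ('a \<Rightarrow> 'a) set \<Rightarrow> 'a \<Rightarrow> ('a \<Rightarrow> 'a) set set monoid" where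
  "germ_abelian_quotient X B G p =
     germ_group X G p Mod
       (commutator_subgroup (germ_group X G p)
          <#>\<^bsub>germ_group X G p\<^esub> germ_subgroup X B G p)"

end

theory Submission
  imports Defs "HOL-Algebra.Zassenhaus" "HOL-Algebra.Free_Abelian_Groups"
begin

text \<open>
  The idea is a transfer. Fix a point \<open>r\<close> and choose for each point \<open>p\<close> of its orbit an element
  \<open>c\<^sub>p\<close> of \<open>B\<close> carrying \<open>r\<close> to \<open>p\<close>; this is possible for all of the \<open>G\<close>-orbit because it is also the
  \<open>B\<close>-orbit. For \<open>g\<close> in \<open>G\<close> the element \<open>c\<^bsub>g(p)\<^esub>\<^sup>-\<^sup>1 g c\<^sub>p\<close> fixes \<open>r\<close>, and its class \<open>\<alpha>(g, p)\<close> in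
  \<open>A\<^sub>r(G)\<close> is trivial as soon as \<open>g\<close> agrees with an element of \<open>B\<close> near \<open>p\<close>, that is, for all but
  finitely many \<open>p\<close>. As \<open>\<alpha>\<close> is a cocycle and \<open>h\<close> permutes the orbit, the product
  \<open>\<psi>\<^sub>r(g) = \<Prod>\<^sub>p \<alpha>(g, p)\<close> over the orbit of \<open>r\<close> is a homomorphism from \<open>G\<close> to the abelian group
  \<open>A\<^sub>r(G)\<close>. Together, the \<open>\<psi>\<^sub>r\<close> for \<open>r\<close> in \<open>R\<close> form a homomorphism \<open>\<Psi>\<close> from \<open>G\<close> to the direct sum,
  which vanishes on \<open>B\<close> and on commutators.

  Everything else follows from elements of \<open>G\<close> with at most one singular point. Let \<open>N\<^sub>r\<close> consist of
  the elements of \<open>G\<close> that fix \<open>r\<close> and are singular at most there. By the third condition on finite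
  germ extensions, every germ at \<open>r\<close> is the germ of an element of \<open>N\<^sub>r\<close> (\<open>localize_germ\<close>). On \<open>N\<^sub>r\<close> the
  map \<open>\<Psi>\<close> takes the class of the germ as its component at \<open>r\<close> and is trivial elsewhere, so that
  \<open>\<Psi>\<close> is onto (\<open>\<Psi>_onto\<close>). Moreover an element of \<open>N\<^sub>r\<close> whose class in \<open>A\<^sub>r(G)\<close> is trivial lies in
  \<open>K = G' B\<close> (\<open>germ_class_kernel\<close>): near \<open>r\<close> it agrees with a product of commutators of elements of
  \<open>N\<^sub>r\<close> and an element of \<open>B\<close>, and the quotient of the two has no singular points left.

  Hence \<open>A\<^sub>r(G)\<close> maps to \<open>G/K\<close>, by sending the class of \<open>n\<close> in \<open>N\<^sub>r\<close> to the coset of \<open>n\<close>, and these maps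
  assemble to a homomorphism \<open>\<Theta>\<close> from the direct sum to \<open>G/K\<close>. The composite of \<open>\<Psi>\<close> and \<open>\<Theta>\<close> is the
  quotient map (\<open>\<Psi>_left_inverse\<close>): singular points can be split off one at a time
  (\<open>peel_singularity\<close>), and an element with one singular point \<open>p\<close> in the orbit of \<open>r\<close> can be moved
  into \<open>N\<^sub>r\<close> by multiplying it with elements of \<open>B\<close> on both sides, which changes neither its coset nor
  its image under \<open>\<Psi>\<close>. So the kernel of \<open>\<Psi>\<close> is exactly \<open>K\<close> (\<open>\<Psi>_kernel\<close>), and passing to
  abelianizations gives the exact sequence (\<open>abelianization_right_exact\<close>).
\<close>

section \<open>Quotients, abelianizations and generalised products\<close>

lemma (in group) normal_of_derived_subset:
  assumes "subgroup M G" and "derived G (carrier G) \<subseteq> M"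
  shows "M \<lhd> G"
  unfolding normal_inv_iff
proof (intro conjI ballI assms(1))
  fix x h assume x: "x \<in> carrier G" and h: "h \<in> M"
  have hG: "h \<in> carrier G"
    using assms(1) h by (rule subgroup.mem_carrier)
  have "x \<otimes> h \<otimes> inv x \<otimes> inv h \<in> derived G (carrier G)"
    unfolding derived_def using x hG by (auto intro: generate.incl)
  then have "(x \<otimes> h \<otimes> inv x \<otimes> inv h) \<otimes> h \<in> M"
    using assms h by (blast intro: subgroup.m_closed)
  then show "x \<otimes> h \<otimes> inv x \<in> M"
    using x hG by (simp add: m_assoc)
qed

lemma (in group) comm_group_Mod_of_derived_subset:
  assumes "subgroup M G" and "derived G (carrier G) \<subseteq> M"
  shows "comm_group (G Mod M)"
proof -
  interpret M: normal M G
    using assms by (rule normal_of_derived_subset)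
  show ?thesis
  proof (rule group.group_comm_groupI [OF M.factorgroup_is_group])
    fix C D assume "C \<in> carrier (G Mod M)" "D \<in> carrier (G Mod M)"
    then obtain x y where x: "x \<in> carrier G" "C = M #> x" and y: "y \<in> carrier G" "D = M #> y"
      by (auto simp: carrier_FactGroup)
    \<comment> \<open>The commutator of \<open>x\<close> and \<open>y\<close> is the quotient of \<open>x y\<close> by \<open>y x\<close>.\<close>
    have "x \<otimes> y \<otimes> inv x \<otimes> inv y \<in> M"
      using assms(2) x y unfolding derived_def by (auto intro: generate.incl)
    then have "x \<otimes> y \<otimes> inv (y \<otimes> x) \<in> M"
      using x y by (simp add: inv_mult_group m_assoc)
    then have "x \<otimes> y \<in> M #> (y \<otimes> x)"
      using x y by (intro M.rcos_module_rev [OF is_group]) auto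
    then have "M #> (x \<otimes> y) = M #> (y \<otimes> x)"
      using x y M.subgroup_axioms by (metis repr_independence m_closed)
    then show "C \<otimes>\<^bsub>G Mod M\<^esub> D = D \<otimes>\<^bsub>G Mod M\<^esub> C"
      using x y by (simp add: M.rcos_sum)
  qed
qed

text \<open>Quotients by \<open>G' H\<close> occur twice below: \<open>A\<^sub>p(G)\<close> is such a quotient of the group of germs, with
  the germs of \<open>B\<close> for \<open>H\<close>, and so is the target of the map inverse to the main isomorphism, with \<open>B\<close>
  itself for \<open>H\<close>.\<close>

lemma (in group) subgroup_derived_mult:
  assumes "subgroup H G"
  shows "subgroup (derived G (carrier G) <#> H) G"
    and "derived G (carrier G) \<subseteq> derived G (carrier G) <#> H"
    and "H \<subseteq> derived G (carrier G) <#> H"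
proof -
  show "subgroup (derived G (carrier G) <#> H) G"
    using derived_self_is_normal assms by (rule mult_norm_subgroup)
  have D: "subgroup (derived G (carrier G)) G"
    by (simp add: derived_is_subgroup)
  show "derived G (carrier G) \<subseteq> derived G (carrier G) <#> H"
  proof
    fix d assume d: "d \<in> derived G (carrier G)"
    then have "d = d \<otimes> \<one>"
      using D subgroup.mem_carrier by fastforce
    with d show "d \<in> derived G (carrier G) <#> H"
      unfolding set_mult_def using subgroup.one_closed [OF assms] by auto
  qed
  show "H \<subseteq> derived G (carrier G) <#> H"
  proof
    fix h assume h: "h \<in> H"
    then have "h = \<one> \<otimes> h"
      using assms subgroup.mem_carrier by fastforce
    with h show "h \<in> derived G (carrier G) <#> H"
      unfolding set_mult_def using subgroup.one_closed [OF D] by auto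
  qed
qed

lemma (in normal) rcos_eq_iff_mem:
  assumes "x \<in> carrier G"
  shows "H #> x = H \<longleftrightarrow> x \<in> H"
  using assms coset_join1 coset_join2 subgroup_axioms by blast

lemma (in normal) group_hom_rcos: "group_hom G (G Mod H) (\<lambda>x. H #> x)"
  by (simp add: group_hom_def group_hom_axioms_def factorgroup_is_group r_coset_hom_Mod)

text \<open>The first isomorphism theorem after abelianizing: everything about the exact sequence follows
  from one homomorphism onto an abelian group whose kernel is generated by commutators and \<open>S\<close>.
  If \<open>S\<close> is perfect, then it already consists of products of commutators, so that the kernel is
  the commutator subgroup.\<close>

lemma (in group_hom) abelianization_right_exact:
  assumes "comm_group H" and "subgroup S G" and onto: "h ` carrier G = carrier H"
    and ker: "kernel G H h = derived G (carrier G) <#> S"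
  shows "\<exists>\<iota> \<psi>. right_exact (abelianization (G\<lparr>carrier := S\<rparr>)) \<iota> (abelianization G) \<psi> H \<and>
           (\<forall>s\<in>S. \<iota> (commutator_subgroup (G\<lparr>carrier := S\<rparr>) #>\<^bsub>G\<lparr>carrier := S\<rparr>\<^esub> s)
                     = commutator_subgroup G #> s)"
    and "perfect_group (G\<lparr>carrier := S\<rparr>) \<Longrightarrow> abelianization G \<cong> H"
proof -
  let ?S = "G\<lparr>carrier := S\<rparr>"
  let ?D = "derived G (carrier G)"
  let ?DS = "derived ?S (carrier ?S)"
  interpret S: group ?S
    using assms(2) G.group_axioms by (rule subgroup.subgroup_is_group)
  interpret D: normal ?D G
    by (rule G.derived_self_is_normal)
  interpret DS: normal ?DS ?S
    by (rule S.derived_self_is_normal)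
  have SG: "S \<subseteq> carrier G"
    using assms(2) by (rule subgroup.subset)
  have DS_eq: "?DS = derived G S"
    using G.derived_consistent [OF _ assms(2)] by simp
  then have DS_D: "?DS \<subseteq> ?D"
    using G.mono_derived [OF SG] by simp
  have D_ker: "?D \<subseteq> kernel G H h" and S_ker: "S \<subseteq> kernel G H h"
    using G.subgroup_derived_mult [OF assms(2)] ker by auto
  have incl: "(\<lambda>s. ?D #> s) \<in> hom ?S (G Mod ?D)"
    using SG by (intro homI) (auto simp: carrier_FactGroup D.rcos_sum subset_iff)
  interpret inc: group_hom ?S "G Mod ?D" "\<lambda>s. ?D #> s"
    using incl by (simp add: group_hom_def group_hom_axioms_def S.group_axioms D.factorgroup_is_group)
  have "?DS \<subseteq> kernel ?S (G Mod ?D) (\<lambda>s. ?D #> s)"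
  proof
    fix d assume "d \<in> ?DS"
    then show "d \<in> kernel ?S (G Mod ?D) (\<lambda>s. ?D #> s)"
      using DS_D DS.subset D.rcos_eq_iff_mem [of d] SG by (auto simp: kernel_def)
  qed
  then obtain \<iota> where \<iota>: "\<iota> \<in> hom (?S Mod ?DS) (G Mod ?D)"
      "\<And>s. s \<in> carrier ?S \<Longrightarrow> \<iota> (?DS #>\<^bsub>?S\<^esub> s) = ?D #> s"
    using inc.FactGroup_universal_kernel [OF DS.normal_axioms] by blast
  obtain \<psi> where \<psi>: "\<psi> \<in> hom (G Mod ?D) H" "\<And>x. x \<in> carrier G \<Longrightarrow> \<psi> (?D #> x) = h x"
    using FactGroup_universal_kernel [OF D.normal_axioms D_ker] by blast
  have ker_\<psi>: "kernel (G Mod ?D) H \<psi> = \<iota> ` carrier (?S Mod ?DS)"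
  proof (intro subset_antisym subsetI)
    fix C assume "C \<in> kernel (G Mod ?D) H \<psi>"
    then obtain x where x: "x \<in> carrier G" "C = ?D #> x" "h x = \<one>\<^bsub>H\<^esub>"
      using \<psi>(2) by (auto simp: kernel_def carrier_FactGroup)
    then have "x \<in> ?D <#> S"
      using ker by (auto simp: kernel_def)
    then obtain d s where ds: "d \<in> ?D" "s \<in> S" "x = d \<otimes> s"
      by (auto simp: set_mult_def)
    then have "?D #> d = ?D" "d \<in> carrier G" "s \<in> carrier G"
      using D.subset SG D.rcos_eq_iff_mem by auto
    then have "C = ?D #> s"
      using x ds G.coset_mult_assoc [OF D.subset] by metis
    also have "\<dots> = \<iota> (?DS #>\<^bsub>?S\<^esub> s)"
      using \<iota>(2) ds by simp
    finally show "C \<in> \<iota> ` carrier (?S Mod ?DS)"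
      using ds by (auto simp: carrier_FactGroup)
  next
    fix C assume "C \<in> \<iota> ` carrier (?S Mod ?DS)"
    then obtain s where "s \<in> S" "C = ?D #> s"
      using \<iota>(2) by (auto simp: carrier_FactGroup)
    then show "C \<in> kernel (G Mod ?D) H \<psi>"
      using S_ker SG \<psi>(2) by (auto simp: kernel_def carrier_FactGroup)
  qed
  have onto_\<psi>: "\<psi> ` carrier (G Mod ?D) = carrier H"
    using onto \<psi>(2) by (force simp: carrier_FactGroup image_image)
  have "right_exact (abelianization ?S) \<iota> (abelianization G) \<psi> H"
    unfolding right_exact_def
    using \<iota>(1) \<psi>(1) ker_\<psi> onto_\<psi> D.factorgroup_is_group DS.factorgroup_is_group
    by (simp add: group_hom_def group_hom_axioms_def)
  then show "\<exists>\<iota> \<psi>. right_exact (abelianization ?S) \<iota> (abelianization G) \<psi> H \<and>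
           (\<forall>s\<in>S. \<iota> (commutator_subgroup ?S #>\<^bsub>?S\<^esub> s) = commutator_subgroup G #> s)"
    using \<iota>(2) by auto
  show "abelianization G \<cong> H" if "perfect_group ?S"
  proof -
    have "S \<subseteq> ?D"
      using that DS_D by (simp add: perfect_group_def)
    then have "?D <#> S \<subseteq> ?D"
      unfolding set_mult_def by (auto intro: D.m_closed)
    then have "kernel G H h = ?D"
      using ker D_ker by blast
    then show ?thesis
      using FactGroup_iso [OF onto] by simp
  qed
qed

lemma r_coset_carrier_update [simp]: "r_coset (K\<lparr>carrier := S\<rparr>) = r_coset K"
  by (simp add: fun_eq_iff r_coset_def)

lemma set_mult_carrier_update [simp]: "set_mult (K\<lparr>carrier := S\<rparr>) = set_mult K"
  by (simp add: fun_eq_iff set_mult_def)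

lemma (in comm_monoid) gfinprod_reindex:
  assumes "inj_on h A" and "f \<in> h ` A \<rightarrow> carrier G"
  shows "gfinprod G f (h ` A) = gfinprod G (\<lambda>x. f (h x)) A"
proof -
  let ?A = "{x \<in> A. f (h x) \<noteq> \<one>}"
  have eq: "{y \<in> h ` A. f y \<noteq> \<one>} = h ` ?A"
    by auto
  have inj: "inj_on h ?A"
    using assms(1) by (rule inj_on_subset) auto
  have "finprod G f (h ` ?A) = finprod G (\<lambda>x. f (h x)) ?A"
    using assms(2) inj by (intro finprod_reindex) auto
  then show ?thesis
    unfolding gfinprod_def eq using finite_image_iff [OF inj] by simp
qed

lemma (in comm_monoid) gfinprod_singleton_support:
  assumes "i \<in> A" and "f i \<in> carrier G" and "\<And>j. j \<in> A \<Longrightarrow> j \<noteq> i \<Longrightarrow> f j = \<one>"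
  shows "gfinprod G f A = f i"
proof -
  have "f \<in> A \<rightarrow> carrier G"
    using assms by (metis Pi_I one_closed)
  then have "gfinprod G f A = gfinprod G f {i}"
    using assms by (intro gfinprod_mono_neutral_cong_right) auto
  then show ?thesis
    using assms(2) by simp
qed

text \<open>This complements the universal property of quotient groups: here the epimorphism need not be a quotient map.\<close>

lemma (in group_hom) factor_through_epi:
  assumes onto: "h ` carrier G = carrier H" and K: "group K" and q: "q \<in> hom G K"
    and ker: "kernel G H h \<subseteq> kernel G K q"
  obtains \<theta> where "\<theta> \<in> hom H K" "\<And>x. x \<in> carrier G \<Longrightarrow> \<theta> (h x) = q x"
proof -
  interpret q: group_hom G K q
    using K q by (simp add: group_hom_def group_hom_axioms_def G.group_axioms)
  have eq: "q x = q y" if "x \<in> carrier G" "y \<in> carrier G" "h x = h y" for x y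
  proof -
    have "x \<otimes> inv y \<in> kernel G H h"
      using that by (simp add: kernel_def)
    then have "x \<otimes> inv y \<in> kernel G K q"
      using ker by blast
    then have "q x \<otimes>\<^bsub>K\<^esub> inv\<^bsub>K\<^esub> q y = \<one>\<^bsub>K\<^esub>"
      using that by (simp add: kernel_def)
    then show ?thesis
      using that q.H.inv_equality q.H.inv_inv q.hom_closed q.H.inv_closed by metis
  qed
  define \<theta> where "\<theta> a = q (SOME x. x \<in> carrier G \<and> h x = a)" for a
  have \<theta>: "\<theta> (h x) = q x" if "x \<in> carrier G" for x
  proof -
    have "\<exists>y. y \<in> carrier G \<and> h y = h x"
      using that by blast
    from someI_ex [OF this] show ?thesis
      unfolding \<theta>_def using eq that by blast
  qed
  show thesis
  proof
    show "\<theta> \<in> hom H K"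
    proof (rule homI)
      fix a assume "a \<in> carrier H"
      then show "\<theta> a \<in> carrier K"
        using onto \<theta> by (metis imageE q.hom_closed)
    next
      fix a b assume "a \<in> carrier H" "b \<in> carrier H"
      then obtain x y where "x \<in> carrier G" "y \<in> carrier G" "a = h x" "b = h y"
        using onto by (metis imageE)
      then show "\<theta> (a \<otimes>\<^bsub>H\<^esub> b) = \<theta> a \<otimes>\<^bsub>K\<^esub> \<theta> b"
        using \<theta> by (metis G.m_closed hom_mult q.hom_mult)
    qed
  qed (rule \<theta>)
qed

lemma sum_group_comm_group:
  assumes "\<And>i. i \<in> I \<Longrightarrow> comm_group (A i)"
  shows "comm_group (sum_group I A)"
proof -
  have grp: "\<And>i. i \<in> I \<Longrightarrow> group (A i)"
    using assms by (simp add: comm_group.axioms)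
  show ?thesis
  proof (rule group.group_comm_groupI)
    show "group (sum_group I A)"
      using grp by simp
    fix x y assume "x \<in> carrier (sum_group I A)" "y \<in> carrier (sum_group I A)"
    then show "x \<otimes>\<^bsub>sum_group I A\<^esub> y = y \<otimes>\<^bsub>sum_group I A\<^esub> x"
      using assms by (auto simp: carrier_sum_group grp PiE_iff comm_groupE(4) intro!: restrict_ext)
  qed
qed

text \<open>By induction on the size of the support: an element is the product of its component at one index
  and an element with smaller support.\<close>

lemma sum_group_subgroup_eqI:
  assumes grp: "\<And>i. i \<in> I \<Longrightarrow> group (A i)" and S: "subgroup S (sum_group I A)"
    and single: "\<And>i a. i \<in> I \<Longrightarrow> a \<in> carrier (A i) \<Longrightarrow> (\<lambda>j\<in>I. if j = i then a else \<one>\<^bsub>A j\<^esub>) \<in> S"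
  shows "S = carrier (sum_group I A)"
proof (rule subset_antisym [OF subgroup.subset [OF S] subsetI])
  fix x assume x: "x \<in> carrier (sum_group I A)"
  have "finite F \<Longrightarrow> x \<in> carrier (sum_group I A) \<Longrightarrow> {i \<in> I. x i \<noteq> \<one>\<^bsub>A i\<^esub>} \<subseteq> F \<Longrightarrow> x \<in> S" for F x
  proof (induction F arbitrary: x rule: finite_induct)
    case empty
    then have "x = \<one>\<^bsub>sum_group I A\<^esub>"
      by (auto simp: carrier_sum_group grp PiE_iff extensional_def restrict_def)
    then show ?case
      using subgroup.one_closed [OF S] by metis
  next
    case (insert i F)
    show ?case
    proof (cases "i \<in> I")
      case False
      with insert show ?thesis by blast
    next
      case True
      have xc: "x \<in> (\<Pi>\<^sub>E i\<in>I. carrier (A i))" "finite {i \<in> I. x i \<noteq> \<one>\<^bsub>A i\<^esub>}"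
        using insert.prems(1) by (simp_all add: carrier_sum_group grp)
      define y where "y = (\<lambda>j\<in>I. if j = i then \<one>\<^bsub>A j\<^esub> else x j)"
      have "y \<in> (\<Pi>\<^sub>E i\<in>I. carrier (A i))"
        using xc(1) by (auto simp: y_def PiE_iff group.is_monoid [OF grp])
      moreover have sub: "{j \<in> I. y j \<noteq> \<one>\<^bsub>A j\<^esub>} \<subseteq> {j \<in> I. x j \<noteq> \<one>\<^bsub>A j\<^esub>} - {i}"
        by (auto simp: y_def)
      ultimately have "y \<in> carrier (sum_group I A)"
        using xc(2) finite_subset [OF sub] by (simp add: carrier_sum_group grp)
      then have "y \<in> S"
        using insert.prems(2) sub by (intro insert.IH) auto
      moreover have "(\<lambda>j\<in>I. if j = i then x i else \<one>\<^bsub>A j\<^esub>) \<in> S"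
        using single True xc(1) by (auto simp: PiE_iff)
      moreover have "x = (\<lambda>j\<in>I. if j = i then x i else \<one>\<^bsub>A j\<^esub>) \<otimes>\<^bsub>sum_group I A\<^esub> y"
      proof
        fix j
        show "x j = ((\<lambda>j\<in>I. if j = i then x i else \<one>\<^bsub>A j\<^esub>) \<otimes>\<^bsub>sum_group I A\<^esub> y) j"
          using xc(1) grp [THEN group.is_monoid]
          by (auto simp: y_def PiE_iff extensional_def)
      qed
      ultimately show ?thesis
        using subgroup.m_closed [OF S] by metis
    qed
  qed
  moreover have "finite {i \<in> I. x i \<noteq> \<one>\<^bsub>A i\<^esub>}"
    using x by (simp add: carrier_sum_group grp)
  ultimately show "x \<in> S"
    using x by blast
qed

section \<open>Composition and inversion of germs\<close>

lemma carrier_homeo_group: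
  "carrier (homeo_group X) = {f \<in> Bij (topspace X). homeomorphic_map X X f}"
  by (simp add: homeo_group_def)

lemma subgroup_homeo_BijGroup: "subgroup (carrier (homeo_group X)) (BijGroup (topspace X))"
proof -
  interpret Bij: group "BijGroup (topspace X)"
    by (rule group_BijGroup)
  show ?thesis
  proof (rule Bij.subgroupI)
    show "carrier (homeo_group X) \<subseteq> carrier (BijGroup (topspace X))"
      by (auto simp: carrier_homeo_group BijGroup_def)
    have "homeomorphic_map X X (\<lambda>x\<in>topspace X. x)"
      by (rule homeomorphic_map_eq [of X X id]) auto
    then show "carrier (homeo_group X) \<noteq> {}"
      using id_Bij by (auto simp: carrier_homeo_group)
  next
    fix f assume "f \<in> carrier (homeo_group X)"
    then have f: "f \<in> Bij (topspace X)" "homeomorphic_map X X f"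
      by (auto simp: carrier_homeo_group)
    then obtain g where g: "homeomorphic_maps X X f g"
      by (auto simp: homeomorphic_map_maps)
    have "g x = (\<lambda>x\<in>topspace X. inv_into (topspace X) f x) x" if "x \<in> topspace X" for x
    proof -
      have "f (g x) = x" "g x \<in> topspace X"
        using g that by (auto simp: homeomorphic_maps_def continuous_map_def)
      moreover have "inj_on f (topspace X)"
        using f by (simp add: Bij_def bij_betw_def)
      ultimately show ?thesis
        using that by (metis inv_into_f_f restrict_apply')
    qed
    moreover have "homeomorphic_map X X g"
      using g homeomorphic_maps_sym homeomorphic_map_maps by blast
    ultimately have "homeomorphic_map X X (\<lambda>x\<in>topspace X. inv_into (topspace X) f x)"
      by (rule homeomorphic_map_eq [rotated])
    then show "inv\<^bsub>BijGroup (topspace X)\<^esub> f \<in> carrier (homeo_group X)"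
      using f by (simp add: inv_BijGroup carrier_homeo_group restrict_inv_into_Bij)
  next
    fix f g assume "f \<in> carrier (homeo_group X)" "g \<in> carrier (homeo_group X)"
    then have fg: "f \<in> Bij (topspace X)" "homeomorphic_map X X f"
        "g \<in> Bij (topspace X)" "homeomorphic_map X X g"
      by (auto simp: carrier_homeo_group)
    have "homeomorphic_map X X (compose (topspace X) f g)"
      using homeomorphic_map_compose [OF fg(4) fg(2)]
      by (rule homeomorphic_map_eq) (simp add: compose_def)
    then show "f \<otimes>\<^bsub>BijGroup (topspace X)\<^esub> g \<in> carrier (homeo_group X)"
      using fg by (simp add: BijGroup_def carrier_homeo_group compose_Bij)
  qed
qed

lemma group_homeo_group: "group (homeo_group X)"
proof -
  have "homeo_group X = (BijGroup (topspace X))\<lparr>carrier := carrier (homeo_group X)\<rparr>"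
    by (simp add: homeo_group_def)
  then show ?thesis
    using group.subgroup_imp_group [OF group_BijGroup subgroup_homeo_BijGroup] by metis
qed

lemma homeo_mult_apply:
  assumes "f \<in> carrier (homeo_group X)" "g \<in> carrier (homeo_group X)" "x \<in> topspace X"
  shows "(f \<otimes>\<^bsub>homeo_group X\<^esub> g) x = f (g x)"
  using assms by (simp add: homeo_group_def BijGroup_def compose_def)

lemma homeo_one_apply: "x \<in> topspace X \<Longrightarrow> \<one>\<^bsub>homeo_group X\<^esub> x = x"
  by (simp add: homeo_group_def BijGroup_def)

lemma homeo_closed:
  assumes "f \<in> carrier (homeo_group X)" "x \<in> topspace X"
  shows "f x \<in> topspace X"
  using assms Bij_imp_funcset by (fastforce simp: carrier_homeo_group)

lemma homeo_inv_closed: "f \<in> carrier (homeo_group X) \<Longrightarrow> inv\<^bsub>homeo_group X\<^esub> f \<in> carrier (homeo_group X)"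
  by (simp add: group.inv_closed group_homeo_group)

lemma homeo_inv_apply:
  assumes "f \<in> carrier (homeo_group X)" "x \<in> topspace X"
  shows "(inv\<^bsub>homeo_group X\<^esub> f) (f x) = x" and "f ((inv\<^bsub>homeo_group X\<^esub> f) x) = x"
proof -
  have "(inv\<^bsub>homeo_group X\<^esub> f \<otimes>\<^bsub>homeo_group X\<^esub> f) x = x" "(f \<otimes>\<^bsub>homeo_group X\<^esub> inv\<^bsub>homeo_group X\<^esub> f) x = x"
    using assms homeo_one_apply
    by (simp_all add: group.l_inv group.r_inv group_homeo_group)
  then show "(inv\<^bsub>homeo_group X\<^esub> f) (f x) = x" and "f ((inv\<^bsub>homeo_group X\<^esub> f) x) = x"
    using assms homeo_inv_closed homeo_mult_apply by metis+
qed

lemma homeo_inj: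
  assumes "f \<in> carrier (homeo_group X)" "x \<in> topspace X" "y \<in> topspace X" "f x = f y"
  shows "x = y"
  using assms homeo_inv_apply by metis

lemma agree_near_refl: "p \<in> topspace X \<Longrightarrow> agree_near X p f f"
  by (auto simp: agree_near_def)

lemma agree_near_sym: "agree_near X p f g \<Longrightarrow> agree_near X p g f"
  by (auto simp: agree_near_def)

lemma agree_near_apply: "agree_near X p f g \<Longrightarrow> f p = g p"
  by (auto simp: agree_near_def)

lemma agree_near_id_iff: "agree_near X p f (\<lambda>x. x) \<longleftrightarrow> agree_near X p f \<one>\<^bsub>homeo_group X\<^esub>"
proof -
  have "(\<forall>x\<in>U. f x = x) \<longleftrightarrow> (\<forall>x\<in>U. f x = \<one>\<^bsub>homeo_group X\<^esub> x)" if "openin X U" for U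
    using openin_subset [OF that] homeo_one_apply by fastforce
  then show ?thesis
    unfolding agree_near_def by blast
qed

lemma agree_near_mult:
  assumes "f \<in> carrier (homeo_group X)" "f' \<in> carrier (homeo_group X)"
    "g \<in> carrier (homeo_group X)" "g' \<in> carrier (homeo_group X)"
    and "agree_near X p f f'" "agree_near X (f p) g g'"
  shows "agree_near X p (g \<otimes>\<^bsub>homeo_group X\<^esub> f) (g' \<otimes>\<^bsub>homeo_group X\<^esub> f')"
proof -
  obtain U V where U: "openin X U" "p \<in> U" "\<forall>x\<in>U. f x = f' x"
    and V: "openin X V" "f p \<in> V" "\<forall>x\<in>V. g x = g' x"
    using assms by (auto simp: agree_near_def)
  have "continuous_map X X f"
    using assms(1) by (simp add: carrier_homeo_group homeomorphic_imp_continuous_map)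
  then have W: "openin X (U \<inter> {x \<in> topspace X. f x \<in> V})"
    using U(1) V(1) openin_continuous_map_preimage by blast
  have "p \<in> U \<inter> {x \<in> topspace X. f x \<in> V}"
    using U V openin_subset by fastforce
  moreover have "\<forall>x \<in> U \<inter> {x \<in> topspace X. f x \<in> V}. (g \<otimes>\<^bsub>homeo_group X\<^esub> f) x = (g' \<otimes>\<^bsub>homeo_group X\<^esub> f') x"
    using assms(1-4) U V by (auto simp: homeo_mult_apply)
  ultimately show ?thesis
    unfolding agree_near_def using W by blast
qed

lemma agree_near_inv:
  assumes "f \<in> carrier (homeo_group X)" "f' \<in> carrier (homeo_group X)" and "agree_near X p f f'"
  shows "agree_near X (f p) (inv\<^bsub>homeo_group X\<^esub> f) (inv\<^bsub>homeo_group X\<^esub> f')"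
proof -
  obtain U where U: "openin X U" "p \<in> U" "\<forall>x\<in>U. f x = f' x"
    using assms by (auto simp: agree_near_def)
  have "open_map X X f"
    using assms(1) by (simp add: carrier_homeo_group homeomorphic_imp_open_map)
  then have "openin X (f ` U)"
    using U(1) by (simp add: open_map_def)
  moreover have "\<forall>y \<in> f ` U. (inv\<^bsub>homeo_group X\<^esub> f) y = (inv\<^bsub>homeo_group X\<^esub> f') y"
  proof (rule ballI, erule imageE)
    fix x y assume "x \<in> U" "y = f x"
    moreover from this have "x \<in> topspace X"
      using U(1) openin_subset by blast
    ultimately show "(inv\<^bsub>homeo_group X\<^esub> f) y = (inv\<^bsub>homeo_group X\<^esub> f') y"
      using U(3) assms(1,2) homeo_inv_apply(1) by metis
  qed
  ultimately show ?thesis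
    unfolding agree_near_def using U(2) by blast
qed

section \<open>Singular sets\<close>

text \<open>A finite germ extension with the same orbits as its base group. Equality of the orbits enters
  pointwise, as the possibility of imitating any element of \<open>G\<close> at a single point by an element of
  \<open>B\<close>.\<close>

locale germ_extension =
  fixes X :: "'a topology" and B G :: "('a \<Rightarrow> 'a) set"
  assumes B_subgroup: "subgroup B (homeo_group X)"
    and G_subgroup: "subgroup G (homeo_group X)"
    and B_subset_G: "B \<subseteq> G"
    and finite_sing: "g \<in> G \<Longrightarrow> finite (sing X B g)"
    and nonsingular: "g \<in> G \<Longrightarrow> sing X B g = {} \<Longrightarrow> g \<in> B"
    and isolate: "g \<in> G \<Longrightarrow> p \<in> sing X B g \<Longrightarrow> \<exists>h\<in>G. sing X B h = {p} \<and> agree_near X p h g"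
    and same_orbits: "g \<in> G \<Longrightarrow> p \<in> topspace X \<Longrightarrow> \<exists>b\<in>B. b p = g p"
begin

abbreviation "H \<equiv> homeo_group X"

sublocale H: group H
  by (rule group_homeo_group)

lemma G_carrier: "g \<in> G \<Longrightarrow> g \<in> carrier H"
  by (rule subgroup.mem_carrier [OF G_subgroup])

lemma B_carrier: "b \<in> B \<Longrightarrow> b \<in> carrier H"
  by (rule G_carrier [OF subsetD [OF B_subset_G]])

lemma G_mult: "g \<in> G \<Longrightarrow> h \<in> G \<Longrightarrow> g \<otimes>\<^bsub>H\<^esub> h \<in> G"
  by (rule subgroup.m_closed [OF G_subgroup])

lemma G_inv: "g \<in> G \<Longrightarrow> inv\<^bsub>H\<^esub> g \<in> G"
  by (rule subgroup.m_inv_closed [OF G_subgroup])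

lemma B_mult: "g \<in> B \<Longrightarrow> h \<in> B \<Longrightarrow> g \<otimes>\<^bsub>H\<^esub> h \<in> B"
  by (rule subgroup.m_closed [OF B_subgroup])

lemma B_inv: "g \<in> B \<Longrightarrow> inv\<^bsub>H\<^esub> g \<in> B"
  by (rule subgroup.m_inv_closed [OF B_subgroup])

lemma B_one: "\<one>\<^bsub>H\<^esub> \<in> B"
  by (rule subgroup.one_closed [OF B_subgroup])

lemmas BG = subsetD [OF B_subset_G]

lemma sing_topspace: "p \<in> sing X B g \<Longrightarrow> p \<in> topspace X"
  by (simp add: sing_def)

lemma not_sing_iff: "p \<in> topspace X \<Longrightarrow> p \<notin> sing X B g \<longleftrightarrow> (\<exists>b\<in>B. agree_near X p g b)"
  by (simp add: sing_def)

lemma sing_base: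
  assumes "b \<in> B"
  shows "sing X B b = {}"
proof -
  have "p \<notin> sing X B b" if "p \<in> topspace X" for p
    unfolding not_sing_iff [OF that] using assms agree_near_refl [OF that] by (rule bexI [rotated])
  then show ?thesis
    using sing_topspace by (metis equals0I)
qed

lemma sing_mult:
  assumes g: "g \<in> G" and h: "h \<in> G" and p: "p \<in> sing X B (g \<otimes>\<^bsub>H\<^esub> h)"
  shows "p \<in> sing X B h \<or> h p \<in> sing X B g"
proof (rule ccontr)
  assume contra: "\<not> ?thesis"
  have pX: "p \<in> topspace X"
    using p by (rule sing_topspace)
  have hpX: "h p \<in> topspace X"
    by (rule homeo_closed [OF G_carrier [OF h] pX])
  obtain a where a: "a \<in> B" "agree_near X p h a"
    using contra not_sing_iff [OF pX] by metis
  obtain b where b: "b \<in> B" "agree_near X (h p) g b"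
    using contra not_sing_iff [OF hpX] by metis
  have "agree_near X p (g \<otimes>\<^bsub>H\<^esub> h) (b \<otimes>\<^bsub>H\<^esub> a)"
    by (rule agree_near_mult [OF G_carrier [OF h] B_carrier [OF a(1)] G_carrier [OF g]
          B_carrier [OF b(1)] a(2) b(2)])
  then show False
    using p not_sing_iff [OF pX] B_mult [OF b(1) a(1)] by metis
qed

text \<open>Inversion of a germ carries it from \<open>q\<close> to \<open>g q\<close>, so the singular points of the inverse are the
  images under \<open>g\<close> of those of \<open>g\<close>.\<close>

lemma sing_inv:
  assumes g: "g \<in> G" and p: "p \<in> sing X B (inv\<^bsub>H\<^esub> g)"
  shows "(inv\<^bsub>H\<^esub> g) p \<in> sing X B g"
proof (rule ccontr)
  let ?q = "(inv\<^bsub>H\<^esub> g) p"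
  assume contra: "?q \<notin> sing X B g"
  have pX: "p \<in> topspace X"
    using p by (rule sing_topspace)
  have qX: "?q \<in> topspace X"
    by (rule homeo_closed [OF G_carrier [OF G_inv [OF g]] pX])
  obtain b where b: "b \<in> B" "agree_near X ?q g b"
    using contra not_sing_iff [OF qX] by metis
  have "agree_near X (g ?q) (inv\<^bsub>H\<^esub> g) (inv\<^bsub>H\<^esub> b)"
    by (rule agree_near_inv [OF G_carrier [OF g] B_carrier [OF b(1)] b(2)])
  then have "agree_near X p (inv\<^bsub>H\<^esub> g) (inv\<^bsub>H\<^esub> b)"
    by (simp only: homeo_inv_apply(2) [OF G_carrier [OF g] pX])
  then show False
    using p not_sing_iff [OF pX] B_inv [OF b(1)] by metis
qed

section \<open>Germs at a point\<close>

lemma Stab_iff: "h \<in> Stab X G r \<longleftrightarrow> h \<in> G \<and> h r = r"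
  by (simp add: Stab_def stabilizer_def)

lemma Stab_base_iff: "h \<in> Stab X B r \<longleftrightarrow> h \<in> B \<and> h r = r"
  by (simp add: Stab_def stabilizer_def)

lemma Stab_subgroup:
  assumes r: "r \<in> topspace X"
  shows "subgroup (Stab X G r) H"
proof (rule H.subgroupI)
  show "Stab X G r \<subseteq> carrier H"
    using G_carrier by (auto simp: Stab_iff)
  have "\<one>\<^bsub>H\<^esub> \<in> Stab X G r"
    using homeo_one_apply [OF r] BG [OF B_one] by (simp add: Stab_iff)
  then show "Stab X G r \<noteq> {}"
    by blast
  show "inv\<^bsub>H\<^esub> g \<in> Stab X G r" if "g \<in> Stab X G r" for g
    using that homeo_inv_apply(1) [OF G_carrier r] by (auto simp: Stab_iff G_inv) (metis)
  show "g \<otimes>\<^bsub>H\<^esub> h \<in> Stab X G r" if "g \<in> Stab X G r" "h \<in> Stab X G r" for g h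
    using that by (auto simp: Stab_iff G_mult homeo_mult_apply [OF _ _ r] G_carrier)
qed

text \<open>The group \<open>N\<^sub>r\<close>, through which germs at \<open>r\<close> are realised by elements without other
  singularities.\<close>

definition local_stab :: "'a \<Rightarrow> ('a \<Rightarrow> 'a) set" where
  "local_stab r = {h \<in> Stab X G r. sing X B h \<subseteq> {r}}"

lemma local_stab_subset: "local_stab r \<subseteq> Stab X G r"
  by (auto simp: local_stab_def)

lemma Stab_base_local: "Stab X B r \<subseteq> local_stab r"
  by (auto simp: local_stab_def Stab_iff Stab_base_iff BG sing_base)

lemma local_stab_subgroup:
  assumes r: "r \<in> topspace X"
  shows "subgroup (local_stab r) H"
proof -
  interpret S: subgroup "Stab X G r" H
    using r by (rule Stab_subgroup)
  show ?thesis
  proof (rule H.subgroupI)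
    show "local_stab r \<subseteq> carrier H"
      using local_stab_subset S.subset by blast
    show "local_stab r \<noteq> {}"
      using homeo_one_apply [OF r] B_one Stab_base_local [of r] Stab_base_iff [of "\<one>\<^bsub>H\<^esub>" r] by blast
    show "inv\<^bsub>H\<^esub> g \<in> local_stab r" if "g \<in> local_stab r" for g
    proof -
      have g: "g \<in> G" "g r = r" "sing X B g \<subseteq> {r}" "inv\<^bsub>H\<^esub> g \<in> Stab X G r"
        using that by (auto simp: local_stab_def Stab_iff [of g])
      have "p = r" if "p \<in> sing X B (inv\<^bsub>H\<^esub> g)" for p
      proof -
        have "(inv\<^bsub>H\<^esub> g) p = r"
          using sing_inv [OF g(1) that] g(3) by blast
        then show ?thesis
          using homeo_inv_apply(2) [OF G_carrier [OF g(1)] sing_topspace [OF that]] g(2) by simp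
      qed
      then show ?thesis
        using g(4) by (auto simp: local_stab_def)
    qed
    show "g \<otimes>\<^bsub>H\<^esub> h \<in> local_stab r" if "g \<in> local_stab r" "h \<in> local_stab r" for g h
    proof -
      have gh: "g \<in> G" "h \<in> G" "h r = r" "sing X B g \<subseteq> {r}" "sing X B h \<subseteq> {r}"
          "g \<otimes>\<^bsub>H\<^esub> h \<in> Stab X G r"
        using that by (auto simp: local_stab_def Stab_iff [of g] Stab_iff [of h])
      have "p = r" if "p \<in> sing X B (g \<otimes>\<^bsub>H\<^esub> h)" for p
      proof -
        have "p = r \<or> h p = h r"
          using sing_mult [OF gh(1,2) that] gh(3-5) by auto
        then show ?thesis
          using homeo_inj [OF G_carrier [OF gh(2)] sing_topspace [OF that] r] by blast
      qed
      then show ?thesis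
        using gh(6) by (auto simp: local_stab_def)
    qed
  qed
qed

text \<open>At a singular point this is the third condition on finite germ extensions; at any other point the
  germ is that of an element of \<open>B\<close>, which has no singular points at all.\<close>

lemma localize_germ:
  assumes r: "r \<in> topspace X" and h: "h \<in> Stab X G r"
  shows "\<exists>h'\<in>local_stab r. agree_near X r h' h"
proof (cases "r \<in> sing X B h")
  case True
  then obtain h' where h': "h' \<in> G" "sing X B h' = {r}" "agree_near X r h' h"
    using isolate [of h r] h by (auto simp: Stab_iff)
  then have "h' r = r"
    using agree_near_apply h by (metis Stab_iff)
  with h' show ?thesis
    by (auto simp: local_stab_def Stab_iff)
next
  case False
  then obtain b where b: "b \<in> B" "agree_near X r h b"
    using r by (auto simp: sing_def)
  then have "b r = r"
    using agree_near_apply h by (metis Stab_iff)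
  with b have "b \<in> local_stab r"
    using Stab_base_local Stab_base_iff by blast
  with b(2) show ?thesis
    by (blast intro: agree_near_sym)
qed

lemma RStab_iff: "h \<in> RStab X G r \<longleftrightarrow> h \<in> Stab X G r \<and> agree_near X r h \<one>\<^bsub>H\<^esub>"
  by (simp add: RStab_def agree_near_id_iff)

lemma agree_near_iff_RStab:
  assumes r: "r \<in> topspace X" and g: "g \<in> Stab X G r" and h: "h \<in> Stab X G r"
  shows "agree_near X r g h \<longleftrightarrow> g \<otimes>\<^bsub>H\<^esub> inv\<^bsub>H\<^esub> h \<in> RStab X G r"
proof -
  interpret S: subgroup "Stab X G r" H
    using r by (rule Stab_subgroup)
  have gH: "g \<in> carrier H" and hH: "h \<in> carrier H" and gr: "g r = r" and hr: "h r = r"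
      and ir: "(inv\<^bsub>H\<^esub> h) r = r"
    using g h S.m_inv_closed [OF h] G_carrier by (auto simp: Stab_iff)
  have refl: "agree_near X r f f" for f
    using r by (rule agree_near_refl)
  show ?thesis
  proof
    assume "agree_near X r g h"
    then have "agree_near X r (g \<otimes>\<^bsub>H\<^esub> inv\<^bsub>H\<^esub> h) (h \<otimes>\<^bsub>H\<^esub> inv\<^bsub>H\<^esub> h)"
      using gH hH ir refl by (intro agree_near_mult) auto
    then show "g \<otimes>\<^bsub>H\<^esub> inv\<^bsub>H\<^esub> h \<in> RStab X G r"
      using g h hH by (simp add: RStab_iff S.m_closed S.m_inv_closed H.r_inv)
  next
    assume "g \<otimes>\<^bsub>H\<^esub> inv\<^bsub>H\<^esub> h \<in> RStab X G r"
    then have "agree_near X r (g \<otimes>\<^bsub>H\<^esub> inv\<^bsub>H\<^esub> h \<otimes>\<^bsub>H\<^esub> h) (\<one>\<^bsub>H\<^esub> \<otimes>\<^bsub>H\<^esub> h)"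
      using gH hH hr refl by (intro agree_near_mult) (auto simp: RStab_iff)
    then show "agree_near X r g h"
      using gH hH by (simp add: H.m_assoc)
  qed
qed

lemma RStab_normal:
  assumes r: "r \<in> topspace X"
  shows "RStab X G r \<lhd> homeo_subgroup X (Stab X G r)"
proof -
  let ?S = "homeo_subgroup X (Stab X G r)"
  interpret S: subgroup "Stab X G r" H
    using r by (rule Stab_subgroup)
  interpret SG: group ?S
    by (rule S.subgroup_is_group [OF H.group_axioms])
  have refl: "agree_near X r f f" for f
    using r by (rule agree_near_refl)
  have fix_r: "h r = r" if "h \<in> Stab X G r" for h
    using that by (simp add: Stab_iff)
  have inv_eq: "inv\<^bsub>?S\<^esub> h = inv\<^bsub>H\<^esub> h" if "h \<in> Stab X G r" for h
    using that Stab_subgroup [OF r] by (simp add: H.m_inv_consistent)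
  have "subgroup (RStab X G r) H"
  proof (rule H.subgroupI)
    show "RStab X G r \<subseteq> carrier H"
      using S.subset by (auto simp: RStab_iff)
    show "RStab X G r \<noteq> {}"
      using S.one_closed refl RStab_iff by blast
    show "inv\<^bsub>H\<^esub> g \<in> RStab X G r" if "g \<in> RStab X G r" for g
      using that agree_near_inv [of g X "\<one>\<^bsub>H\<^esub>" r] S.mem_carrier fix_r [of g]
      by (simp add: RStab_iff S.m_inv_closed)
    show "g \<otimes>\<^bsub>H\<^esub> h \<in> RStab X G r" if "g \<in> RStab X G r" "h \<in> RStab X G r" for g h
      using that agree_near_mult [of h X "\<one>\<^bsub>H\<^esub>" g "\<one>\<^bsub>H\<^esub>" r] S.mem_carrier fix_r [of h]
      by (simp add: RStab_iff S.m_closed)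
  qed
  then have sub: "subgroup (RStab X G r) ?S"
    using H.subgroup_incl Stab_subgroup [OF r] by (metis RStab_iff subsetI)
  show ?thesis
    unfolding SG.normal_inv_iff
  proof (intro conjI sub ballI)
    fix x h assume "x \<in> carrier ?S" and h: "h \<in> RStab X G r"
    then have x: "x \<in> Stab X G r" and hS: "h \<in> Stab X G r"
      by (auto simp: RStab_iff)
    have "agree_near X r (x \<otimes>\<^bsub>H\<^esub> h) (x \<otimes>\<^bsub>H\<^esub> \<one>\<^bsub>H\<^esub>)"
      using h x hS refl S.mem_carrier by (intro agree_near_mult) (auto simp: RStab_iff fix_r)
    then have "agree_near X r (x \<otimes>\<^bsub>H\<^esub> h) x"
      using x S.mem_carrier by simp
    then show "x \<otimes>\<^bsub>?S\<^esub> h \<otimes>\<^bsub>?S\<^esub> inv\<^bsub>?S\<^esub> x \<in> RStab X G r"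
      using agree_near_iff_RStab [OF r S.m_closed [OF x hS] x] x by (simp add: inv_eq)
  qed
qed

section \<open>The abelian groups of germs\<close>

abbreviation "A r \<equiv> germ_abelian_quotient X B G r"

definition germ :: "'a \<Rightarrow> ('a \<Rightarrow> 'a) \<Rightarrow> ('a \<Rightarrow> 'a) set" where
  "germ r h = RStab X G r #>\<^bsub>H\<^esub> h"

text \<open>The normal subgroup of \<open>(G)\<^sub>r\<close> whose quotient is \<open>A\<^sub>r(G)\<close>.\<close>

definition M :: "'a \<Rightarrow> ('a \<Rightarrow> 'a) set set" where
  "M r = commutator_subgroup (germ_group X G r) <#>\<^bsub>germ_group X G r\<^esub> germ_subgroup X B G r"

definition germ_class :: "'a \<Rightarrow> ('a \<Rightarrow> 'a) \<Rightarrow> ('a \<Rightarrow> 'a) set set" where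
  "germ_class r h = M r #>\<^bsub>germ_group X G r\<^esub> germ r h"

lemma A_eq: "A r = germ_group X G r Mod M r"
  by (simp add: germ_abelian_quotient_def M_def)

text \<open>The product \<open>G' B\<close>, which turns out to be the kernel of the map to the direct sum.\<close>

definition K :: "('a \<Rightarrow> 'a) set" where
  "K = commutator_subgroup (homeo_subgroup X G) <#>\<^bsub>homeo_subgroup X G\<^esub> B"

lemma group_G: "group (homeo_subgroup X G)"
  by (rule subgroup.subgroup_is_group [OF G_subgroup H.group_axioms])

lemma B_subgroup_G: "subgroup B (homeo_subgroup X G)"
  by (rule H.subgroup_incl [OF B_subgroup G_subgroup B_subset_G])

lemma K_subgroup: "subgroup K (homeo_subgroup X G)"
  and derived_K: "derived H G \<subseteq> K" and B_K: "B \<subseteq> K"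
proof -
  show "subgroup K (homeo_subgroup X G)" "B \<subseteq> K"
    unfolding K_def by (rule group.subgroup_derived_mult [OF group_G B_subgroup_G])+
  have "commutator_subgroup (homeo_subgroup X G) \<subseteq> K"
    unfolding K_def by (rule group.subgroup_derived_mult [OF group_G B_subgroup_G])
  then show "derived H G \<subseteq> K"
    using H.derived_consistent [OF subset_refl G_subgroup] by simp
qed

lemma K_mult: "g \<in> K \<Longrightarrow> h \<in> K \<Longrightarrow> g \<otimes>\<^bsub>H\<^esub> h \<in> K"
  using subgroup.m_closed [OF K_subgroup, of g h] by simp

context
  fixes r assumes r: "r \<in> topspace X"
begin

lemma germ_group_hom: "group_hom (homeo_subgroup X (Stab X G r)) (germ_group X G r) (germ r)"
  using normal.group_hom_rcos [OF RStab_normal [OF r]] by (simp add: germ_group_def germ_def [abs_def])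

lemma germ_group_group: "group (germ_group X G r)"
  using germ_group_hom by (rule group_hom.axioms)

lemma germ_eq_iff:
  assumes g: "g \<in> Stab X G r" and h: "h \<in> Stab X G r"
  shows "germ r g = germ r h \<longleftrightarrow> agree_near X r g h"
proof -
  interpret N: normal "RStab X G r" "homeo_subgroup X (Stab X G r)"
    using r by (rule RStab_normal)
  have "inv\<^bsub>homeo_subgroup X (Stab X G r)\<^esub> h = inv\<^bsub>H\<^esub> h"
    using h Stab_subgroup [OF r] by (simp add: H.m_inv_consistent)
  then have "g \<in> germ r h \<longleftrightarrow> agree_near X r g h"
    using N.rcos_module [OF N.is_group, of h g] g h agree_near_iff_RStab [OF r g h]
    by (simp add: germ_def)
  moreover have "germ r g = germ r h \<longleftrightarrow> g \<in> germ r h"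
    using N.repr_independence [of g "RStab X G r" h] N.rcos_self [of g "RStab X G r"] g h N.subgroup_axioms
    by (auto simp: germ_def)
  ultimately show ?thesis
    by simp
qed

lemma germ_local_stab: "germ r ` local_stab r = carrier (germ_group X G r)"
proof -
  have "germ r h \<in> germ r ` local_stab r" if h: "h \<in> Stab X G r" for h
  proof -
    obtain h' where h': "h' \<in> local_stab r" "agree_near X r h' h"
      using localize_germ [OF r h] by blast
    then have "germ r h = germ r h'"
      using germ_eq_iff [OF subsetD [OF local_stab_subset h'(1)] h] by simp
    then show ?thesis
      using h'(1) by (rule image_eqI)
  qed
  then have "germ r ` local_stab r = germ r ` Stab X G r"
    using image_mono [OF local_stab_subset, of "germ r" r] by (auto intro!: subset_antisym)
  then show ?thesis
    by (simp add: germ_group_def germ_def [abs_def] carrier_FactGroup)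
qed

lemma RStab_base_iff: "h \<in> RStab X B r \<longleftrightarrow> h \<in> B \<and> h \<in> RStab X G r"
  using BG by (auto simp: RStab_def Stab_iff Stab_base_iff)

text \<open>The cosets of the smaller group \<open>RStab X B r\<close> that enter the definition are absorbed by
  \<open>RStab X G r\<close>.\<close>

lemma germ_subgroup_eq: "germ_subgroup X B G r = germ r ` Stab X B r"
proof -
  interpret N: normal "RStab X G r" "homeo_subgroup X (Stab X G r)"
    using r by (rule RStab_normal)
  have sub: "RStab X G r \<subseteq> carrier H"
    using Stab_iff G_carrier by (auto simp: RStab_iff)
  have subB: "RStab X B r \<subseteq> RStab X G r"
    using RStab_base_iff by blast
  have oneB: "\<one>\<^bsub>H\<^esub> \<in> RStab X B r"
    using RStab_base_iff B_one subgroup.one_closed [OF N.subgroup_axioms] by simp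
  have "RStab X G r <#>\<^bsub>H\<^esub> RStab X B r = RStab X G r"
  proof
    show "RStab X G r <#>\<^bsub>H\<^esub> RStab X B r \<subseteq> RStab X G r"
      using subB subgroup.m_closed [OF N.subgroup_axioms] by (auto simp: set_mult_def)
    show "RStab X G r \<subseteq> RStab X G r <#>\<^bsub>H\<^esub> RStab X B r"
    proof
      fix x assume x: "x \<in> RStab X G r"
      then have "x = x \<otimes>\<^bsub>H\<^esub> \<one>\<^bsub>H\<^esub>"
        using sub by auto
      with x oneB show "x \<in> RStab X G r <#>\<^bsub>H\<^esub> RStab X B r"
        unfolding set_mult_def by blast
    qed
  qed
  then have "RStab X G r <#>\<^bsub>H\<^esub> (RStab X B r #>\<^bsub>H\<^esub> b) = germ r b" if "b \<in> Stab X B r" for b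
    using that B_carrier sub subB H.setmult_rcos_assoc [of "RStab X G r" "RStab X B r" b]
    by (auto simp: germ_def Stab_base_iff)
  then show ?thesis
    by (simp add: germ_subgroup_def germ_group_def carrier_FactGroup image_image cong: image_cong)
qed

lemma germ_subgroup_subgroup: "subgroup (germ_subgroup X B G r) (germ_group X G r)"
proof -
  interpret g: group_hom "homeo_subgroup X (Stab X G r)" "germ_group X G r" "germ r"
    by (rule germ_group_hom)
  have eq: "Stab X B r = Stab X G r \<inter> B"
    using BG by (auto simp: Stab_iff Stab_base_iff)
  have "subgroup (Stab X B r) H"
    unfolding eq by (rule H.subgroups_Inter_pair [OF Stab_subgroup [OF r] B_subgroup])
  then have "subgroup (Stab X B r) (homeo_subgroup X (Stab X G r))"
    using H.subgroup_incl [OF _ Stab_subgroup [OF r]] eq by blast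
  then show ?thesis
    unfolding germ_subgroup_eq by (rule g.subgroup_img_is_subgroup)
qed

lemma M_subgroup: "subgroup (M r) (germ_group X G r)"
  and derived_M: "commutator_subgroup (germ_group X G r) \<subseteq> M r"
  and germ_subgroup_M: "germ_subgroup X B G r \<subseteq> M r"
  unfolding M_def by (rule group.subgroup_derived_mult [OF germ_group_group germ_subgroup_subgroup])+

lemma M_normal: "M r \<lhd> germ_group X G r"
  by (rule group.normal_of_derived_subset [OF germ_group_group M_subgroup derived_M])

lemma A_comm_group: "comm_group (A r)"
  unfolding A_eq by (rule group.comm_group_Mod_of_derived_subset [OF germ_group_group M_subgroup derived_M])

lemma germ_class_hom: "group_hom (homeo_subgroup X (Stab X G r)) (A r) (germ_class r)"
proof -
  interpret M: normal "M r" "germ_group X G r"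
    by (rule M_normal)
  interpret g: group_hom "homeo_subgroup X (Stab X G r)" "germ_group X G r" "germ r"
    by (rule germ_group_hom)
  have "(\<lambda>C. M r #>\<^bsub>germ_group X G r\<^esub> C) \<circ> germ r \<in> hom (homeo_subgroup X (Stab X G r)) (A r)"
    unfolding A_eq using g.homh M.r_coset_hom_Mod by (rule hom_compose)
  then show ?thesis
    using g.G.group_axioms comm_group.axioms(2) [OF A_comm_group]
    by (simp add: group_hom_def group_hom_axioms_def germ_class_def [abs_def] comp_def)
qed

lemma germ_class_closed: "h \<in> Stab X G r \<Longrightarrow> germ_class r h \<in> carrier (A r)"
  using group_hom.hom_closed [OF germ_class_hom, of h] by simp

lemma germ_class_mult:
  "g \<in> Stab X G r \<Longrightarrow> h \<in> Stab X G r \<Longrightarrow>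
    germ_class r (g \<otimes>\<^bsub>H\<^esub> h) = germ_class r g \<otimes>\<^bsub>A r\<^esub> germ_class r h"
  using group_hom.hom_mult [OF germ_class_hom, of g h] by simp

lemma germ_class_agree:
  assumes "g \<in> Stab X G r" "h \<in> Stab X G r" "agree_near X r g h"
  shows "germ_class r g = germ_class r h"
  using assms(3) germ_eq_iff [OF assms(1,2)] by (simp add: germ_class_def)

lemma germ_class_eq_one_iff:
  assumes h: "h \<in> Stab X G r"
  shows "germ_class r h = \<one>\<^bsub>A r\<^esub> \<longleftrightarrow> germ r h \<in> M r"
proof -
  have "germ r h \<in> carrier (germ_group X G r)"
    using group_hom.hom_closed [OF germ_group_hom] h by simp
  then show ?thesis
    unfolding A_eq germ_class_def one_FactGroup by (rule normal.rcos_eq_iff_mem [OF M_normal])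
qed

lemma germ_class_base:
  assumes b: "b \<in> B" "b r = r"
  shows "germ_class r b = \<one>\<^bsub>A r\<^esub>"
proof -
  have "b \<in> Stab X G r" "germ r b \<in> germ_subgroup X B G r"
    using b by (simp_all add: germ_subgroup_eq Stab_base_iff Stab_iff BG)
  then show ?thesis
    using germ_class_eq_one_iff germ_subgroup_M by blast
qed

lemma germ_class_local_stab: "germ_class r ` local_stab r = carrier (A r)"
proof -
  have "germ_class r ` local_stab r = (\<lambda>C. M r #>\<^bsub>germ_group X G r\<^esub> C) ` germ r ` local_stab r"
    by (simp add: image_image germ_class_def)
  then show ?thesis
    by (simp add: germ_local_stab A_eq carrier_FactGroup)
qed

text \<open>Since \<open>N\<^sub>r\<close> maps onto the group of germs, commutators of germs are germs of commutators of
  elements of \<open>N\<^sub>r\<close>. This keeps the comparison element \<open>n b\<close> inside \<open>N\<^sub>r\<close>, so that dividing \<open>h\<close> by it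
  removes the only possible singularity. Lifting to arbitrary elements of the stabilizer would leave
  singularities away from \<open>r\<close>.\<close>

lemma germ_class_kernel:
  assumes h: "h \<in> local_stab r" and one: "germ_class r h = \<one>\<^bsub>A r\<^esub>"
  shows "h \<in> K"
proof -
  let ?S = "homeo_subgroup X (Stab X G r)"
  interpret N: subgroup "local_stab r" H
    using r by (rule local_stab_subgroup)
  interpret g: group_hom ?S "germ_group X G r" "germ r"
    by (rule germ_group_hom)
  have hS: "h \<in> Stab X G r"
    using h by (rule subsetD [OF local_stab_subset])
  have "germ r h \<in> M r"
    using one by (simp only: germ_class_eq_one_iff [OF hS])
  then obtain d b where d: "d \<in> commutator_subgroup (germ_group X G r)" and b: "b \<in> Stab X B r"
      and eq: "germ r h = d \<otimes>\<^bsub>germ_group X G r\<^esub> germ r b"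
    by (auto simp: M_def set_mult_def germ_subgroup_eq)
  have "commutator_subgroup (germ_group X G r) = germ r ` derived ?S (local_stab r)"
    using g.derived_img [of "local_stab r"] local_stab_subset by (simp add: germ_local_stab)
  then obtain n where n: "n \<in> derived H (local_stab r)" "d = germ r n"
    using d H.derived_consistent [OF local_stab_subset Stab_subgroup [OF r]] by auto
  have nN: "n \<in> local_stab r"
    using n(1) H.derived_incl [OF subset_refl N.subgroup_axioms] by blast
  have bN: "b \<in> local_stab r"
    using b Stab_base_local by blast
  have nb: "n \<otimes>\<^bsub>H\<^esub> b \<in> local_stab r"
    using nN bN by (rule N.m_closed)
  have "local_stab r \<subseteq> G"
    by (auto simp: local_stab_def Stab_iff)
  then have "derived H (local_stab r) \<subseteq> K"
    using H.mono_derived derived_K by blast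
  then have nbK: "n \<otimes>\<^bsub>H\<^esub> b \<in> K"
    using n(1) b B_K by (intro K_mult) (auto simp: Stab_base_iff)
  have "germ r h = germ r (n \<otimes>\<^bsub>H\<^esub> b)"
    using eq n(2) nN bN local_stab_subset g.hom_mult [of n b] by auto
  then have agr: "agree_near X r h (n \<otimes>\<^bsub>H\<^esub> b)"
    using germ_eq_iff hS nb local_stab_subset by blast
  \<comment> \<open>The quotient is the identity near \<open>r\<close> and has no singular point elsewhere, so it is in \<open>B\<close>.\<close>
  let ?u = "h \<otimes>\<^bsub>H\<^esub> inv\<^bsub>H\<^esub> (n \<otimes>\<^bsub>H\<^esub> b)"
  have u: "?u \<in> local_stab r"
    by (rule N.m_closed [OF h N.m_inv_closed [OF nb]])
  have "?u \<in> RStab X G r"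
    using agree_near_iff_RStab [OF r hS] agr nb local_stab_subset by blast
  then have "r \<notin> sing X B ?u"
    using B_one not_sing_iff [OF r] by (auto simp: RStab_iff)
  then have "sing X B ?u = {}"
    using u by (auto simp: local_stab_def)
  then have "?u \<in> B"
    using u nonsingular by (auto simp: local_stab_def Stab_iff)
  then have "?u \<otimes>\<^bsub>H\<^esub> (n \<otimes>\<^bsub>H\<^esub> b) \<in> K"
    using B_K nbK K_mult by blast
  moreover have "h \<otimes>\<^bsub>H\<^esub> inv\<^bsub>H\<^esub> x \<otimes>\<^bsub>H\<^esub> x = h" if "x \<in> carrier H" for x
    using that N.mem_carrier [OF h] by (simp add: H.m_assoc)
  ultimately show ?thesis
    using N.mem_carrier [OF nb] by metis
qed

end

section \<open>The germ homomorphism\<close>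

lemma germ_class_nonsingular:
  assumes r: "r \<in> topspace X" and h: "h \<in> Stab X G r" and ns: "r \<notin> sing X B h"
  shows "germ_class r h = \<one>\<^bsub>A r\<^esub>"
proof -
  obtain b where b: "b \<in> B" "agree_near X r h b"
    using ns not_sing_iff [OF r] by blast
  have br: "b r = r"
    using agree_near_apply [OF b(2)] h by (simp add: Stab_iff)
  have "germ_class r h = germ_class r b"
    using germ_class_agree [OF r h _ b(2)] b(1) br by (simp add: Stab_iff BG)
  then show ?thesis
    using germ_class_base [OF r b(1) br] by simp
qed

definition orb :: "'a \<Rightarrow> 'a set" where
  "orb r = (\<lambda>b. b r) ` B"

text \<open>An arbitrary choice of the element \<open>c\<^sub>p\<close>, not normalised to be the identity for \<open>p = r\<close>. Two
  choices differ by an element of the stabilizer of \<open>r\<close> in \<open>B\<close>, whose germ has trivial class in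
  \<open>A\<^sub>r(G)\<close>.\<close>

definition carry :: "'a \<Rightarrow> 'a \<Rightarrow> 'a \<Rightarrow> 'a" where
  "carry r p = (SOME b. b \<in> B \<and> b r = p)"

text \<open>The germ of \<open>g\<close> at \<open>p\<close>, carried over to the base point \<open>r\<close>.\<close>

definition pull :: "'a \<Rightarrow> ('a \<Rightarrow> 'a) \<Rightarrow> 'a \<Rightarrow> 'a \<Rightarrow> 'a" where
  "pull r g p = inv\<^bsub>H\<^esub> (carry r (g p)) \<otimes>\<^bsub>H\<^esub> (g \<otimes>\<^bsub>H\<^esub> carry r p)"

definition \<psi> :: "'a \<Rightarrow> ('a \<Rightarrow> 'a) \<Rightarrow> ('a \<Rightarrow> 'a) set set" where
  "\<psi> r g = gfinprod (A r) (\<lambda>p. germ_class r (pull r g p)) (orb r)"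

lemma carry:
  assumes "p \<in> orb r"
  shows "carry r p \<in> B" and "carry r p r = p"
proof -
  have "\<exists>b. b \<in> B \<and> b r = p"
    using assms by (auto simp: orb_def)
  from someI_ex [OF this] show "carry r p \<in> B" and "carry r p r = p"
    by (simp_all add: carry_def)
qed

context
  fixes r assumes r: "r \<in> topspace X"
begin

lemma orb_topspace: "p \<in> orb r \<Longrightarrow> p \<in> topspace X"
  using homeo_closed [OF B_carrier r] by (auto simp: orb_def)

lemma orb_self: "r \<in> orb r"
  unfolding orb_def using B_one homeo_one_apply [OF r] by (metis imageI)

lemma orb_closed:
  assumes "p \<in> orb r" "g \<in> G"
  shows "g p \<in> orb r"
proof -
  obtain b where b: "b \<in> B" "b p = g p"
    using same_orbits [OF assms(2) orb_topspace [OF assms(1)]] by blast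
  then have "(b \<otimes>\<^bsub>H\<^esub> carry r p) r = g p"
    using homeo_mult_apply [OF B_carrier B_carrier r] carry [OF assms(1)] by simp
  then show ?thesis
    unfolding orb_def using B_mult [OF b(1) carry(1) [OF assms(1)]] by (metis imageI)
qed

lemma orb_image:
  assumes g: "g \<in> G"
  shows "g ` orb r = orb r" and "inj_on g (orb r)"
proof -
  show "inj_on g (orb r)"
    using homeo_inj [OF G_carrier [OF g]] orb_topspace by (auto intro!: inj_onI)
  have "p \<in> g ` orb r" if "p \<in> orb r" for p
    using homeo_inv_apply(2) [OF G_carrier [OF g] orb_topspace [OF that]] orb_closed [OF that G_inv [OF g]]
    by (metis imageI)
  then show "g ` orb r = orb r"
    using orb_closed [OF _ g] by (auto intro!: subset_antisym)
qed

lemma pull_Stab: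
  assumes g: "g \<in> G" and p: "p \<in> orb r"
  shows "pull r g p \<in> Stab X G r"
proof -
  note c = carry [OF p] and d = carry [OF orb_closed [OF p g]]
  have gc: "g \<otimes>\<^bsub>H\<^esub> carry r p \<in> G"
    by (rule G_mult [OF g BG [OF c(1)]])
  have "(g \<otimes>\<^bsub>H\<^esub> carry r p) r = carry r (g p) r"
    using homeo_mult_apply [OF G_carrier [OF g] B_carrier [OF c(1)] r] c(2) d(2) by simp
  then have "pull r g p r = r"
    unfolding pull_def
    using homeo_mult_apply [OF B_carrier [OF B_inv [OF d(1)]] G_carrier [OF gc] r]
      homeo_inv_apply(1) [OF B_carrier [OF d(1)] r] by simp
  then show ?thesis
    using G_mult [OF BG [OF B_inv [OF d(1)]] gc] by (simp add: Stab_iff pull_def)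
qed

text \<open>The cocycle identity, on the level of homeomorphisms: \<open>c\<^bsub>h(p)\<^esub>\<close> and its inverse cancel in the
  middle.\<close>

lemma pull_mult:
  assumes g: "g \<in> G" and h: "h \<in> G" and p: "p \<in> orb r"
  shows "pull r (g \<otimes>\<^bsub>H\<^esub> h) p = pull r g (h p) \<otimes>\<^bsub>H\<^esub> pull r h p"
proof -
  have eq: "(g \<otimes>\<^bsub>H\<^esub> h) p = g (h p)"
    by (rule homeo_mult_apply [OF G_carrier [OF g] G_carrier [OF h] orb_topspace [OF p]])
  have hp: "h p \<in> orb r" and ghp: "g (h p) \<in> orb r"
    using orb_closed g h p by blast+
  note carr = B_carrier [OF carry(1) [OF p]] B_carrier [OF carry(1) [OF hp]]
    B_carrier [OF carry(1) [OF ghp]] G_carrier [OF g] G_carrier [OF h]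
  have "carry r (h p) \<otimes>\<^bsub>H\<^esub> (inv\<^bsub>H\<^esub> carry r (h p) \<otimes>\<^bsub>H\<^esub> x) = x" if "x \<in> carrier H" for x
    using carr that by (simp flip: H.m_assoc)
  then show ?thesis
    unfolding pull_def eq using carr by (simp add: H.m_assoc)
qed

lemma sing_pull:
  assumes g: "g \<in> G" and p: "p \<in> orb r" and q: "q \<in> sing X B (pull r g p)"
  shows "carry r p q \<in> sing X B g"
proof -
  note c = carry(1) [OF p] and d = carry(1) [OF orb_closed [OF p g]]
  have "q \<in> sing X B (g \<otimes>\<^bsub>H\<^esub> carry r p)"
    using sing_mult [OF BG [OF B_inv [OF d]] G_mult [OF g BG [OF c]]] q sing_base [OF B_inv [OF d]]
    by (auto simp: pull_def)
  then show ?thesis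
    using sing_mult [OF g BG [OF c]] sing_base [OF c] by blast
qed

lemma pull_local:
  assumes g: "g \<in> G" and p: "p \<in> orb r" and s: "sing X B g \<subseteq> {p}"
  shows "pull r g p \<in> local_stab r"
proof -
  have "q = r" if "q \<in> sing X B (pull r g p)" for q
  proof -
    have "carry r p q = carry r p r"
      using sing_pull [OF g p that] s carry(2) [OF p] by auto
    then show ?thesis
      by (rule homeo_inj [OF B_carrier [OF carry(1) [OF p]] sing_topspace [OF that] r])
  qed
  then show ?thesis
    using pull_Stab [OF g p] by (auto simp: local_stab_def)
qed

lemma class_pull_closed:
  "g \<in> G \<Longrightarrow> p \<in> orb r \<Longrightarrow> germ_class r (pull r g p) \<in> carrier (A r)"
  by (rule germ_class_closed [OF r pull_Stab])

lemma class_pull_nonsingular: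
  assumes g: "g \<in> G" and p: "p \<in> orb r" and ns: "p \<notin> sing X B g"
  shows "germ_class r (pull r g p) = \<one>\<^bsub>A r\<^esub>"
proof -
  have "r \<notin> sing X B (pull r g p)"
    using sing_pull [OF g p] ns carry(2) [OF p] by metis
  then show ?thesis
    by (rule germ_class_nonsingular [OF r pull_Stab [OF g p]])
qed

lemma finite_class_pull:
  assumes g: "g \<in> G"
  shows "finite {p \<in> orb r. germ_class r (pull r g p) \<noteq> \<one>\<^bsub>A r\<^esub>}"
  by (rule finite_subset [OF _ finite_sing [OF g]]) (auto intro: ccontr dest: class_pull_nonsingular [OF g])

lemma comm_monoid_A: "comm_monoid (A r)"
  by (rule comm_group.axioms(1) [OF A_comm_group [OF r]])

lemma \<psi>_closed: "g \<in> G \<Longrightarrow> \<psi> r g \<in> carrier (A r)"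
  unfolding \<psi>_def by (rule comm_monoid.gfinprod_closed [OF comm_monoid_A]) (simp add: class_pull_closed)

text \<open>By the cocycle identity the product splits into two; in the factor belonging to \<open>g\<close> the points
  are shifted by \<open>h\<close>, which only permutes the orbit.\<close>

lemma \<psi>_mult:
  assumes g: "g \<in> G" and h: "h \<in> G"
  shows "\<psi> r (g \<otimes>\<^bsub>H\<^esub> h) = \<psi> r g \<otimes>\<^bsub>A r\<^esub> \<psi> r h"
proof -
  interpret A: comm_monoid "A r"
    by (rule comm_monoid_A)
  let ?f = "\<lambda>g p. germ_class r (pull r g p)"
  have closed: "?f g \<in> orb r \<rightarrow> carrier (A r)" "?f h \<in> orb r \<rightarrow> carrier (A r)"
      "(\<lambda>p. ?f g (h p)) \<in> orb r \<rightarrow> carrier (A r)"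
    using g h class_pull_closed orb_closed by auto
  have "inj_on h {p \<in> orb r. ?f g (h p) \<noteq> \<one>\<^bsub>A r\<^esub>}"
    by (rule inj_on_subset [OF orb_image(2) [OF h]]) auto
  moreover have "h ` {p \<in> orb r. ?f g (h p) \<noteq> \<one>\<^bsub>A r\<^esub>} \<subseteq> {p \<in> orb r. ?f g p \<noteq> \<one>\<^bsub>A r\<^esub>}"
    using orb_closed [OF _ h] by auto
  ultimately have fin: "finite {p \<in> orb r. ?f g (h p) \<noteq> \<one>\<^bsub>A r\<^esub>}"
    using finite_class_pull [OF g] by (rule inj_on_finite)
  have cocycle: "?f (g \<otimes>\<^bsub>H\<^esub> h) p = ?f g (h p) \<otimes>\<^bsub>A r\<^esub> ?f h p" if "p \<in> orb r" for p
    using that by (simp add: pull_mult [OF g h] germ_class_mult [OF r] pull_Stab g h orb_closed)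
  have "?f (g \<otimes>\<^bsub>H\<^esub> h) \<in> orb r \<rightarrow> carrier (A r)"
    using class_pull_closed [OF G_mult [OF g h]] by auto
  then have "\<psi> r (g \<otimes>\<^bsub>H\<^esub> h) = gfinprod (A r) (\<lambda>p. ?f g (h p) \<otimes>\<^bsub>A r\<^esub> ?f h p) (orb r)"
    unfolding \<psi>_def by (rule A.gfinprod_cong [OF refl]) (simp add: simp_implies_def cocycle)
  also have "\<dots> = gfinprod (A r) (\<lambda>p. ?f g (h p)) (orb r) \<otimes>\<^bsub>A r\<^esub> \<psi> r h"
    unfolding \<psi>_def by (rule A.gfinprod_distrib [OF fin finite_class_pull [OF h] closed(3,2)])
  also have "gfinprod (A r) (\<lambda>p. ?f g (h p)) (orb r) = \<psi> r g"
    using A.gfinprod_reindex [OF orb_image(2) [OF h], of "?f g"] closed(1)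
    unfolding \<psi>_def orb_image(1) [OF h] by simp
  finally show ?thesis .
qed

lemma \<psi>_nonsingular:
  assumes g: "g \<in> G" and ns: "sing X B g \<inter> orb r = {}"
  shows "\<psi> r g = \<one>\<^bsub>A r\<^esub>"
proof -
  have no_factor: "{p \<in> orb r. germ_class r (pull r g p) \<noteq> \<one>\<^bsub>A r\<^esub>} = {}"
    using class_pull_nonsingular [OF g] ns by blast
  show ?thesis
    unfolding \<psi>_def gfinprod_def no_factor by (simp add: comm_monoid.finprod_empty [OF comm_monoid_A])
qed

lemma \<psi>_single:
  assumes g: "g \<in> G" and p: "p \<in> orb r" and s: "sing X B g \<subseteq> {p}"
  shows "\<psi> r g = germ_class r (pull r g p)"
  unfolding \<psi>_def
proof (rule comm_monoid.gfinprod_singleton_support [OF comm_monoid_A p])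
  show "germ_class r (pull r g p) \<in> carrier (A r)"
    by (rule class_pull_closed [OF g p])
  show "germ_class r (pull r g q) = \<one>\<^bsub>A r\<^esub>" if "q \<in> orb r" "q \<noteq> p" for q
    using class_pull_nonsingular [OF g that(1)] that(2) s by blast
qed

text \<open>The chosen element carrying \<open>r\<close> to itself conjugates the germ by a germ of \<open>B\<close>, whose class is
  trivial.\<close>

lemma \<psi>_local_stab:
  assumes n: "n \<in> local_stab r"
  shows "\<psi> r n = germ_class r n"
proof -
  interpret A: comm_group "A r"
    by (rule A_comm_group [OF r])
  have nS: "n \<in> Stab X G r" and nG: "n \<in> G" and nr: "n r = r" and s: "sing X B n \<subseteq> {r}"
    using n by (auto simp: local_stab_def Stab_iff)
  note c = carry [OF orb_self]
  have cS: "carry r r \<in> Stab X G r" and iS: "inv\<^bsub>H\<^esub> carry r r \<in> Stab X G r"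
    using c BG subgroup.m_inv_closed [OF Stab_subgroup [OF r]] by (auto simp: Stab_iff)
  have "\<psi> r n = germ_class r (inv\<^bsub>H\<^esub> carry r r \<otimes>\<^bsub>H\<^esub> (n \<otimes>\<^bsub>H\<^esub> carry r r))"
    using \<psi>_single [OF nG orb_self s] by (simp add: pull_def nr)
  also have "\<dots> = germ_class r (inv\<^bsub>H\<^esub> carry r r) \<otimes>\<^bsub>A r\<^esub> (germ_class r n \<otimes>\<^bsub>A r\<^esub> germ_class r (carry r r))"
    using germ_class_mult [OF r iS] germ_class_mult [OF r nS cS]
      subgroup.m_closed [OF Stab_subgroup [OF r] nS cS] by simp
  also have "\<dots> = germ_class r n"
    using germ_class_base [OF r c] germ_class_base [OF r B_inv [OF c(1)]] iS
      germ_class_closed [OF r nS] by (simp add: Stab_iff)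
  finally show ?thesis .
qed

end

lemma orb_sym:
  assumes "r \<in> topspace X" "p \<in> orb r"
  shows "r \<in> orb p"
proof -
  note c = carry [OF assms(2)]
  have "(inv\<^bsub>H\<^esub> carry r p) p = r"
    using homeo_inv_apply(1) [OF B_carrier [OF c(1)] assms(1)] c(2) by simp
  then show ?thesis
    unfolding orb_def using B_inv [OF c(1)] by (metis imageI)
qed

text \<open>Dividing by an element with the same germ at \<open>p\<close> and no other singularity removes \<open>p\<close> and moves
  the remaining singular points by that element. In particular their number drops, which drives the
  induction in \<open>\<Psi>_left_inverse\<close>.\<close>

lemma peel_singularity:
  assumes g: "g \<in> G" and h: "h \<in> G" and p: "p \<in> sing X B g" and s: "sing X B h = {p}"
    and agr: "agree_near X p h g"
  shows "sing X B (g \<otimes>\<^bsub>H\<^esub> inv\<^bsub>H\<^esub> h) \<subseteq> h ` (sing X B g - {p})"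
proof
  fix x assume x: "x \<in> sing X B (g \<otimes>\<^bsub>H\<^esub> inv\<^bsub>H\<^esub> h)"
  let ?y = "(inv\<^bsub>H\<^esub> h) x"
  have xX: "x \<in> topspace X" and pX: "p \<in> topspace X"
    using x p by (auto dest: sing_topspace)
  have hy: "h ?y = x"
    by (rule homeo_inv_apply(2) [OF G_carrier [OF h] xX])
  have hpX: "h p \<in> topspace X"
    by (rule homeo_closed [OF G_carrier [OF h] pX])
  have "?y \<in> sing X B g"
    using sing_mult [OF g G_inv [OF h] x] sing_inv [OF h, of x] s p by auto
  moreover have "?y \<noteq> p"
  proof
    assume "?y = p"
    then have x_eq: "x = h p"
      using hy by simp
    have "agree_near X (h p) (inv\<^bsub>H\<^esub> h) (inv\<^bsub>H\<^esub> g)"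
      by (rule agree_near_inv [OF G_carrier [OF h] G_carrier [OF g] agr])
    moreover have "agree_near X ((inv\<^bsub>H\<^esub> h) (h p)) g g"
      using homeo_inv_apply(1) [OF G_carrier [OF h] pX] agree_near_refl [OF pX] by simp
    ultimately have "agree_near X (h p) (g \<otimes>\<^bsub>H\<^esub> inv\<^bsub>H\<^esub> h) (g \<otimes>\<^bsub>H\<^esub> inv\<^bsub>H\<^esub> g)"
      using g h by (intro agree_near_mult) (simp_all add: G_carrier)
    then have "agree_near X (h p) (g \<otimes>\<^bsub>H\<^esub> inv\<^bsub>H\<^esub> h) \<one>\<^bsub>H\<^esub>"
      using G_carrier [OF g] by simp
    then show False
      using x x_eq B_one not_sing_iff [OF hpX] by metis
  qed
  ultimately show "x \<in> h ` (sing X B g - {p})"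
    using hy by (metis DiffI imageI singletonD)
qed

section \<open>Exactness\<close>

abbreviation "Q \<equiv> homeo_subgroup X G Mod K"

definition q :: "('a \<Rightarrow> 'a) \<Rightarrow> ('a \<Rightarrow> 'a) set" where
  "q g = K #>\<^bsub>H\<^esub> g"

lemma derived_subset_K: "commutator_subgroup (homeo_subgroup X G) \<subseteq> K"
  using derived_K H.derived_consistent [OF subset_refl G_subgroup] by simp

lemma Q_comm_group: "comm_group Q"
  by (rule group.comm_group_Mod_of_derived_subset [OF group_G K_subgroup derived_subset_K])

lemma K_normal: "K \<lhd> homeo_subgroup X G"
  by (rule group.normal_of_derived_subset [OF group_G K_subgroup derived_subset_K])

lemma q_hom: "group_hom (homeo_subgroup X G) Q q"
  using normal.group_hom_rcos [OF K_normal] by (simp add: q_def [abs_def])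

lemma q_mult: "g \<in> G \<Longrightarrow> h \<in> G \<Longrightarrow> q (g \<otimes>\<^bsub>H\<^esub> h) = q g \<otimes>\<^bsub>Q\<^esub> q h"
  using group_hom.hom_mult [OF q_hom, of g h] by simp

lemma q_closed: "g \<in> G \<Longrightarrow> q g \<in> carrier Q"
  using group_hom.hom_closed [OF q_hom, of g] by simp

lemma q_eq_one_iff: "g \<in> G \<Longrightarrow> q g = \<one>\<^bsub>Q\<^esub> \<longleftrightarrow> g \<in> K"
  using normal.rcos_eq_iff_mem [OF K_normal, of g] by (simp add: q_def)

lemma q_base: "b \<in> B \<Longrightarrow> q b = \<one>\<^bsub>Q\<^esub>"
  by (rule iffD2 [OF q_eq_one_iff [OF BG] subsetD [OF B_K]])

text \<open>Carrying an element over to the base point multiplies it by elements of \<open>B\<close>, which die in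
  \<open>G/K\<close>.\<close>

lemma q_pull:
  assumes r: "r \<in> topspace X" and g: "g \<in> G" and p: "p \<in> orb r"
  shows "q (pull r g p) = q g"
proof -
  interpret Q: comm_group Q
    by (rule Q_comm_group)
  note c = carry(1) [OF p] and d = B_inv [OF carry(1) [OF orb_closed [OF r p g]]]
  show ?thesis
    unfolding pull_def
    using q_mult [OF BG [OF d] G_mult [OF g BG [OF c]]] q_mult [OF g BG [OF c]]
      q_base [OF c] q_base [OF d] Q.l_one [OF q_closed [OF g]] Q.r_one [OF q_closed [OF g]] by metis
qed

text \<open>The map from \<open>A\<^sub>r(G)\<close> to \<open>G/K\<close> is well defined by \<open>germ_class_kernel\<close> and everywhere defined because
  \<open>N\<^sub>r\<close> maps onto \<open>A\<^sub>r(G)\<close>.\<close>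

lemma germ_class_lift:
  assumes r: "r \<in> topspace X"
  shows "\<exists>\<theta>. \<theta> \<in> hom (A r) Q \<and> (\<forall>n\<in>local_stab r. \<theta> (germ_class r n) = q n)"
proof -
  let ?N = "homeo_subgroup X (local_stab r)"
  have NG: "local_stab r \<subseteq> G"
    by (auto simp: local_stab_def Stab_iff)
  have "group ?N"
    by (rule subgroup.subgroup_is_group [OF local_stab_subgroup [OF r] H.group_axioms])
  moreover have "germ_class r \<in> hom ?N (A r)"
    using germ_class_closed [OF r subsetD [OF local_stab_subset]]
      germ_class_mult [OF r subsetD [OF local_stab_subset] subsetD [OF local_stab_subset]]
    by (intro homI) auto
  ultimately interpret c: group_hom ?N "A r" "germ_class r"
    using comm_group.axioms(2) [OF A_comm_group [OF r]]
    by (simp add: group_hom_def group_hom_axioms_def)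
  have onto: "germ_class r ` carrier ?N = carrier (A r)"
    using germ_class_local_stab [OF r] by simp
  have hom: "q \<in> hom ?N Q"
    by (rule homI) (simp_all add: q_closed q_mult subsetD [OF NG] del: mult_FactGroup)
  have "n \<in> kernel ?N Q q" if "n \<in> kernel ?N (A r) (germ_class r)" for n
  proof -
    have n: "n \<in> local_stab r" "germ_class r n = \<one>\<^bsub>A r\<^esub>"
      using that by (simp_all add: kernel_def)
    have "q n = \<one>\<^bsub>Q\<^esub>"
      by (rule iffD2 [OF q_eq_one_iff [OF subsetD [OF NG n(1)]] germ_class_kernel [OF r n]])
    then show ?thesis
      using n(1) by (simp add: kernel_def)
  qed
  then have "kernel ?N (A r) (germ_class r) \<subseteq> kernel ?N Q q"
    by (rule subsetI)
  from c.factor_through_epi [OF onto comm_group.axioms(2) [OF Q_comm_group] hom this]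
  obtain \<theta> where "\<theta> \<in> hom (A r) Q" "\<And>n. n \<in> carrier ?N \<Longrightarrow> \<theta> (germ_class r n) = q n"
    by blast
  then show ?thesis
    by auto
qed

context
  fixes R assumes R: "orbit_representatives X B R"
begin

lemma R_topspace: "r \<in> R \<Longrightarrow> r \<in> topspace X"
  using R by (auto simp: orbit_representatives_def)

lemma homeo_orbits_eq: "homeo_orbits X B = orb ` topspace X"
  by (auto simp: orbits_def orbit_def orb_def)

lemma R_cover:
  assumes p: "p \<in> topspace X"
  shows "\<exists>r\<in>R. p \<in> orb r"
proof -
  have "\<exists>r. r \<in> R \<and> r \<in> orb p"
    using R p unfolding orbit_representatives_def homeo_orbits_eq by (metis imageI)
  then show ?thesis
    using orb_sym [OF p] by blast
qed

lemma R_disjoint: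
  assumes r: "r \<in> R" and s: "s \<in> R" and p: "p \<in> orb r" "p \<in> orb s"
  shows "r = s"
proof -
  have pX: "p \<in> topspace X"
    by (rule orb_topspace [OF R_topspace [OF r] p(1)])
  have "r \<in> orb p" "s \<in> orb p"
    using orb_sym R_topspace r s p by blast+
  then show ?thesis
    using R r s pX unfolding orbit_representatives_def homeo_orbits_eq by (metis imageI)
qed

definition \<Psi> :: "('a \<Rightarrow> 'a) \<Rightarrow> 'a \<Rightarrow> ('a \<Rightarrow> 'a) set set" where
  "\<Psi> g = (\<lambda>r\<in>R. \<psi> r g)"

lemma A_group: "r \<in> R \<Longrightarrow> group (A r)"
  by (rule comm_group.axioms(2) [OF A_comm_group [OF R_topspace]])

lemma sum_comm_group: "comm_group (sum_group R A)"
  by (rule sum_group_comm_group) (rule A_comm_group [OF R_topspace])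

lemma \<Psi>_closed:
  assumes g: "g \<in> G"
  shows "\<Psi> g \<in> carrier (sum_group R A)"
proof -
  \<comment> \<open>Each singular point lies in the orbit of only one representative,
    so only finitely many components differ from 1.\<close>
  define rep where "rep p = (SOME r. r \<in> R \<and> p \<in> orb r)" for p
  have rep: "rep p = r" if "r \<in> R" "p \<in> orb r" for p r
  proof -
    have "\<exists>r. r \<in> R \<and> p \<in> orb r"
      using that by blast
    from someI_ex [OF this] show ?thesis
      unfolding rep_def using R_disjoint that by blast
  qed
  have "{r \<in> R. \<psi> r g \<noteq> \<one>\<^bsub>A r\<^esub>} \<subseteq> rep ` sing X B g"
  proof
    fix r assume "r \<in> {r \<in> R. \<psi> r g \<noteq> \<one>\<^bsub>A r\<^esub>}"
    then have r: "r \<in> R" "\<psi> r g \<noteq> \<one>\<^bsub>A r\<^esub>"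
      by auto
    then obtain p where "p \<in> sing X B g" "p \<in> orb r"
      using \<psi>_nonsingular [OF R_topspace [OF r(1)] g] by blast
    then show "r \<in> rep ` sing X B g"
      using rep [OF r(1)] by (metis imageI)
  qed
  then have "finite {r \<in> R. \<psi> r g \<noteq> \<one>\<^bsub>A r\<^esub>}"
    using finite_sing [OF g] by (blast intro: finite_subset)
  moreover have "{r \<in> R. \<Psi> g r \<noteq> \<one>\<^bsub>A r\<^esub>} = {r \<in> R. \<psi> r g \<noteq> \<one>\<^bsub>A r\<^esub>}"
    by (auto simp: \<Psi>_def)
  moreover have "\<Psi> g \<in> (\<Pi>\<^sub>E r\<in>R. carrier (A r))"
    unfolding \<Psi>_def using \<psi>_closed [OF R_topspace g] by auto
  ultimately show ?thesis
    using A_group by (simp add: carrier_sum_group)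
qed

lemma \<Psi>_hom: "group_hom (homeo_subgroup X G) (sum_group R A) \<Psi>"
proof -
  have "\<Psi> \<in> hom (homeo_subgroup X G) (sum_group R A)"
  proof (rule homI)
    fix g h assume "g \<in> carrier (homeo_subgroup X G)" "h \<in> carrier (homeo_subgroup X G)"
    then show "\<Psi> (g \<otimes>\<^bsub>homeo_subgroup X G\<^esub> h) = \<Psi> g \<otimes>\<^bsub>sum_group R A\<^esub> \<Psi> h"
      using \<psi>_mult [OF R_topspace] by (auto simp: \<Psi>_def intro!: restrict_ext)
  qed (simp add: \<Psi>_closed)
  then show ?thesis
    using group_G comm_group.axioms(2) [OF sum_comm_group]
    by (simp add: group_hom_def group_hom_axioms_def)
qed

lemma \<Psi>_base:
  assumes "b \<in> B"
  shows "\<Psi> b = \<one>\<^bsub>sum_group R A\<^esub>"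
proof -
  have "\<psi> r b = \<one>\<^bsub>A r\<^esub>" if "r \<in> R" for r
    by (rule \<psi>_nonsingular [OF R_topspace [OF that] BG [OF assms]]) (simp add: sing_base [OF assms])
  then show ?thesis
    unfolding \<Psi>_def one_sum_group by (rule restrict_ext)
qed

lemma \<Psi>_local_stab:
  assumes r: "r \<in> R" and n: "n \<in> local_stab r"
  shows "\<Psi> n = (\<lambda>s\<in>R. if s = r then germ_class r n else \<one>\<^bsub>A s\<^esub>)"
proof -
  have nG: "n \<in> G" and sn: "sing X B n \<subseteq> {r}"
    using n by (auto simp: local_stab_def Stab_iff)
  have "\<psi> s n = (if s = r then germ_class r n else \<one>\<^bsub>A s\<^esub>)" if s: "s \<in> R" for s
  proof (cases "s = r")
    case True
    then show ?thesis
      using \<psi>_local_stab [OF R_topspace [OF r] n] by simp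
  next
    case False
    then have "r \<notin> orb s"
      using R_disjoint [OF r s orb_self [OF R_topspace [OF r]]] by blast
    then have "sing X B n \<inter> orb s = {}"
      using sn by blast
    then show ?thesis
      using \<psi>_nonsingular [OF R_topspace [OF s] nG] False by simp
  qed
  then show ?thesis
    unfolding \<Psi>_def by (rule restrict_ext)
qed

lemma \<Psi>_onto: "\<Psi> ` G = carrier (sum_group R A)"
proof (rule sum_group_subgroup_eqI [OF A_group])
  show "subgroup (\<Psi> ` G) (sum_group R A)"
    using group_hom.img_is_subgroup [OF \<Psi>_hom] by simp
  fix r a assume r: "r \<in> R" and "a \<in> carrier (A r)"
  then obtain n where n: "n \<in> local_stab r" "a = germ_class r n"
    using germ_class_local_stab [OF R_topspace [OF r]] by blast
  then have "(\<lambda>s\<in>R. if s = r then a else \<one>\<^bsub>A s\<^esub>) = \<Psi> n" "n \<in> G"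
    using \<Psi>_local_stab [OF r n(1)] by (auto simp: local_stab_def Stab_iff)
  then show "(\<lambda>s\<in>R. if s = r then a else \<one>\<^bsub>A s\<^esub>) \<in> \<Psi> ` G"
    by (metis imageI)
qed

lemma \<Psi>_pull:
  assumes r: "r \<in> R" and g: "g \<in> G" and p: "p \<in> orb r" and s: "sing X B g \<subseteq> {p}"
  shows "\<Psi> g = \<Psi> (pull r g p)"
proof -
  have n: "pull r g p \<in> local_stab r"
    by (rule pull_local [OF R_topspace [OF r] g p s])
  have "\<psi> t g = (if t = r then germ_class r (pull r g p) else \<one>\<^bsub>A t\<^esub>)" if t: "t \<in> R" for t
  proof (cases "t = r")
    case True
    then show ?thesis
      using \<psi>_single [OF R_topspace [OF r] g p s] by simp
  next
    case False
    then have "p \<notin> orb t"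
      using R_disjoint [OF r t p] by blast
    then have "sing X B g \<inter> orb t = {}"
      using s by blast
    then show ?thesis
      using \<psi>_nonsingular [OF R_topspace [OF t] g] False by simp
  qed
  then show ?thesis
    unfolding \<Psi>_local_stab [OF r n] by (simp add: \<Psi>_def cong: restrict_cong)
qed

text \<open>Both sides are homomorphisms, so it suffices to compare them on elements with at most one singular
  point; induction on the number of singular points reduces to these. For a single point \<open>p\<close>, both
  sides only depend on the element of \<open>N\<^sub>r\<close> obtained by carrying over to the representative \<open>r\<close> of the
  orbit of \<open>p\<close>.\<close>

lemma \<Psi>_left_inverse:
  "\<exists>\<Theta>. \<Theta> \<in> hom (sum_group R A) Q \<and> (\<forall>g\<in>G. \<Theta> (\<Psi> g) = q g)"
proof -
  interpret Q: comm_group Q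
    by (rule Q_comm_group)
  obtain \<theta> where \<theta>: "\<And>r. r \<in> R \<Longrightarrow> \<theta> r \<in> hom (A r) Q"
      "\<And>r n. r \<in> R \<Longrightarrow> n \<in> local_stab r \<Longrightarrow> \<theta> r (germ_class r n) = q n"
    using germ_class_lift [OF R_topspace] by metis
  define \<Theta> where "\<Theta> x = gfinprod Q (\<lambda>r. \<theta> r (x r)) R" for x
  have hom: "\<Theta> \<in> hom (sum_group R A) Q"
    unfolding \<Theta>_def [abs_def] using \<theta>(1) A_group by (rule Q.hom_group_sum)
  have \<Theta>_mult: "\<Theta> (\<Psi> (g \<otimes>\<^bsub>H\<^esub> h)) = \<Theta> (\<Psi> g) \<otimes>\<^bsub>Q\<^esub> \<Theta> (\<Psi> h)" if "g \<in> G" "h \<in> G" for g h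
    using group_hom.hom_mult [OF \<Psi>_hom, of g h] that hom_mult [OF hom \<Psi>_closed \<Psi>_closed, of g h] by simp
  have local: "\<Theta> (\<Psi> n) = q n" if r: "r \<in> R" and n: "n \<in> local_stab r" for r n
  proof -
    have nG: "n \<in> G"
      using n by (auto simp: local_stab_def Stab_iff)
    have at_r: "\<theta> r (\<Psi> n r) = q n"
      using \<theta>(2) [OF r n] r by (simp add: \<Psi>_local_stab [OF r n])
    have off_r: "\<theta> s (\<Psi> n s) = \<one>\<^bsub>Q\<^esub>" if "s \<in> R" "s \<noteq> r" for s
      using hom_one [OF \<theta>(1) [OF that(1)] A_group [OF that(1)] Q.group_axioms] that
      by (simp add: \<Psi>_local_stab [OF r n])
    have "\<Theta> (\<Psi> n) = \<theta> r (\<Psi> n r)"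
      unfolding \<Theta>_def
    proof (rule Q.gfinprod_singleton_support [OF r])
      show "\<theta> r (\<Psi> n r) \<in> carrier Q"
        using q_closed [OF nG] by (simp only: at_r)
    qed (rule off_r)
    then show ?thesis
      using at_r by (rule trans)
  qed
  have "\<Theta> (\<Psi> g) = q g" if "g \<in> G" for g
    using that
  proof (induction "card (sing X B g)" arbitrary: g rule: less_induct)
    case less
    note g = less.prems
    show ?case
    proof (cases "sing X B g = {}")
      case True
      then have "g \<in> B"
        by (rule nonsingular [OF g])
      then show ?thesis
        using hom_one [OF hom comm_group.axioms(2) [OF sum_comm_group] Q.group_axioms]
          \<Psi>_base [of g] q_base [of g] by simp
    next
      case False
      then obtain p where p: "p \<in> sing X B g"
        by blast
      obtain h where h: "h \<in> G" "sing X B h = {p}" "agree_near X p h g"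
        using isolate [OF g p] by blast
      obtain r where r: "r \<in> R" "p \<in> orb r"
        using R_cover [OF sing_topspace [OF p]] by blast
      have "\<Theta> (\<Psi> h) = \<Theta> (\<Psi> (pull r h p))"
        using \<Psi>_pull [OF r(1) h(1) r(2)] h(2) by simp
      also have "\<dots> = q (pull r h p)"
        using pull_local [OF R_topspace [OF r(1)] h(1) r(2)] h(2) by (intro local [OF r(1)]) simp
      also have "\<dots> = q h"
        by (rule q_pull [OF R_topspace [OF r(1)] h(1) r(2)])
      finally have h_eq: "\<Theta> (\<Psi> h) = q h" .
      let ?k = "g \<otimes>\<^bsub>H\<^esub> inv\<^bsub>H\<^esub> h"
      have k: "?k \<in> G"
        by (rule G_mult [OF g G_inv [OF h(1)]])
      have "card (sing X B ?k) \<le> card (h ` (sing X B g - {p}))"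
        using peel_singularity [OF g h(1) p h(2,3)] finite_sing [OF g] by (intro card_mono) auto
      also have "\<dots> \<le> card (sing X B g - {p})"
        using finite_sing [OF g] by (intro card_image_le) simp
      also have "\<dots> < card (sing X B g)"
        using finite_sing [OF g] p by (rule card_Diff1_less)
      finally have k_eq: "\<Theta> (\<Psi> ?k) = q ?k"
        using k by (rule less.hyps)
      have "g = ?k \<otimes>\<^bsub>H\<^esub> h"
        using G_carrier [OF g] G_carrier [OF h(1)] by (simp add: H.m_assoc)
      then show ?thesis
        using \<Theta>_mult [OF k h(1)] q_mult [OF k h(1)] k_eq h_eq by simp
    qed
  qed
  with hom show ?thesis
    by blast
qed

text \<open>The inclusion from left to right is where the map \<open>\<Theta>\<close> back to \<open>G/K\<close> is needed; the other one holds
  because the direct sum is abelian and elements of \<open>B\<close> have no singular points.\<close>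

lemma \<Psi>_kernel: "kernel (homeo_subgroup X G) (sum_group R A) \<Psi> = K"
proof
  interpret \<Psi>: group_hom "homeo_subgroup X G" "sum_group R A" \<Psi>
    by (rule \<Psi>_hom)
  have ker: "g \<in> kernel (homeo_subgroup X G) (sum_group R A) \<Psi> \<longleftrightarrow> g \<in> G \<and> \<Psi> g = \<one>\<^bsub>sum_group R A\<^esub>" for g
    by (simp add: kernel_def)
  obtain \<Theta> where \<Theta>: "\<Theta> \<in> hom (sum_group R A) Q" "\<And>g. g \<in> G \<Longrightarrow> \<Theta> (\<Psi> g) = q g"
    using \<Psi>_left_inverse by blast
  show "kernel (homeo_subgroup X G) (sum_group R A) \<Psi> \<subseteq> K"
  proof
    fix g assume "g \<in> kernel (homeo_subgroup X G) (sum_group R A) \<Psi>"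
    then have g: "g \<in> G" "\<Psi> g = \<one>\<^bsub>sum_group R A\<^esub>"
      by (simp_all only: ker)
    have "q g = \<one>\<^bsub>Q\<^esub>"
      using \<Theta>(2) [OF g(1)] g(2)
        hom_one [OF \<Theta>(1) \<Psi>.H.group_axioms comm_group.axioms(2) [OF Q_comm_group]] by metis
    then show "g \<in> K"
      using q_eq_one_iff [OF g(1)] by blast
  qed
  have comm: "commutator_subgroup (homeo_subgroup X G) \<subseteq> kernel (homeo_subgroup X G) (sum_group R A) \<Psi>"
  proof
    fix d assume d: "d \<in> commutator_subgroup (homeo_subgroup X G)"
    have "\<Psi> ` carrier (homeo_subgroup X G) \<subseteq> carrier (sum_group R A)"
      using \<Psi>_closed by auto
    then have "\<Psi> ` commutator_subgroup (homeo_subgroup X G) = {\<one>\<^bsub>sum_group R A\<^esub>}"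
      unfolding \<Psi>.derived_img [OF subset_refl, symmetric]
      by (rule comm_group.derived_eq_singleton [OF sum_comm_group])
    then have "\<Psi> d = \<one>\<^bsub>sum_group R A\<^esub>"
      using d by blast
    moreover have "d \<in> G"
      using d \<Psi>.G.derived_in_carrier [OF subset_refl] by auto
    ultimately show "d \<in> kernel (homeo_subgroup X G) (sum_group R A) \<Psi>"
      by (simp only: ker)
  qed
  have "B \<subseteq> kernel (homeo_subgroup X G) (sum_group R A) \<Psi>"
    using \<Psi>_base BG by (auto simp only: ker)
  with comm show "K \<subseteq> kernel (homeo_subgroup X G) (sum_group R A) \<Psi>"
    using subgroup.m_closed [OF \<Psi>.subgroup_kernel] by (auto simp only: K_def set_mult_def)
qed

end

end

lemma germ_extensionI:
  assumes ext: "finite_germ_extension X B G" and orbits: "homeo_orbits X B = homeo_orbits X G"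
  shows "germ_extension X B G"
proof -
  have B: "subgroup B (homeo_group X)" and G: "subgroup G (homeo_group X)"
    and BG: "B \<subseteq> G" and B_eq: "B = {g \<in> G. sing X B g = {}}"
    and fin: "\<forall>g\<in>G. finite (sing X B g)"
    and isolate: "\<forall>g\<in>G. \<forall>p\<in>sing X B g. \<exists>h\<in>G. sing X B h = {p} \<and> agree_near X p h g"
    using ext unfolding finite_germ_extension_def by blast+
  have one: "\<one>\<^bsub>homeo_group X\<^esub> \<in> B"
    by (rule subgroup.one_closed [OF B])
  have orbit: "\<exists>b\<in>B. b p = g p" if g: "g \<in> G" and p: "p \<in> topspace X" for g p
  proof -
    have "{g p |g. g \<in> G} \<in> homeo_orbits X B"
      unfolding orbits using p by (auto simp: orbits_def orbit_def)
    then obtain x where x: "x \<in> topspace X" "{g p |g. g \<in> G} = {b x |b. b \<in> B}"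
      by (auto simp: orbits_def orbit_def)
    \<comment> \<open>The \<open>G\<close>-orbit of \<open>p\<close> is the \<open>B\<close>-orbit of some point \<open>x\<close>;
      both \<open>p\<close> and \<open>g p\<close> are reached from there within \<open>B\<close>.\<close>
    obtain b where b: "b \<in> B" "g p = b x"
      using x(2) g by blast
    have "\<one>\<^bsub>homeo_group X\<^esub> p \<in> {b x |b. b \<in> B}"
      unfolding x(2) [symmetric] using one BG by blast
    then obtain c where c: "c \<in> B" "p = c x"
      using homeo_one_apply [OF p] by auto
    have cH: "c \<in> carrier (homeo_group X)" and bH: "b \<in> carrier (homeo_group X)"
      using subgroup.mem_carrier [OF B] b c by blast+
    have "(b \<otimes>\<^bsub>homeo_group X\<^esub> inv\<^bsub>homeo_group X\<^esub> c) p = b ((inv\<^bsub>homeo_group X\<^esub> c) p)"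
      by (rule homeo_mult_apply [OF bH homeo_inv_closed [OF cH] p])
    also have "\<dots> = g p"
      using homeo_inv_apply(1) [OF cH x(1)] b(2) c(2) by simp
    finally show ?thesis
      using subgroup.m_closed [OF B b(1) subgroup.m_inv_closed [OF B c(1)]] by blast
  qed
  show ?thesis
  proof (rule germ_extension.intro [OF B G BG])
    show "finite (sing X B g)" if "g \<in> G" for g
      using fin that by (rule bspec)
    show "g \<in> B" if "g \<in> G" "sing X B g = {}" for g
      by (subst B_eq) (simp add: that)
    show "\<exists>h\<in>G. sing X B h = {p} \<and> agree_near X p h g" if "g \<in> G" "p \<in> sing X B g" for g p
      by (rule bspec [OF bspec [OF isolate that(1)] that(2)])
  qed (rule orbit)
qed

theorem theorem1p4:
  fixes X :: "'a topology" and B G :: "('a \<Rightarrow> 'a) set" and R :: "'a set"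
  assumes "Hausdorff_space X"
    and "finite_germ_extension X B G"
    and "\<not> has_global_fixed_point X B"
    and "homeo_orbits X B = homeo_orbits X G"
    and "orbit_representatives X B R"
  shows "(\<exists>\<iota> \<psi>.
            right_exact (abelianization (homeo_subgroup X B)) \<iota>
                        (abelianization (homeo_subgroup X G)) \<psi>
                        (sum_group R (germ_abelian_quotient X B G)) \<and>
            (\<forall>b\<in>B. \<iota> (commutator_subgroup (homeo_subgroup X B) #>\<^bsub>homeo_subgroup X B\<^esub> b) =
                      commutator_subgroup (homeo_subgroup X G) #>\<^bsub>homeo_subgroup X G\<^esub> b))
       \<and> (perfect_group (homeo_subgroup X B) \<longrightarrow>
            abelianization (homeo_subgroup X G) \<cong> sum_group R (germ_abelian_quotient X B G))"
proof -
  interpret germ_extension X B G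
    using assms(2,4) by (rule germ_extensionI)
  note R = assms(5)
  interpret \<Psi>: group_hom "homeo_subgroup X G" "sum_group R (germ_abelian_quotient X B G)" "\<Psi> R"
    by (rule \<Psi>_hom [OF R])
  have onto: "\<Psi> R ` carrier (homeo_subgroup X G) = carrier (sum_group R (germ_abelian_quotient X B G))"
    using \<Psi>_onto [OF R] by simp
  have ker: "kernel (homeo_subgroup X G) (sum_group R (germ_abelian_quotient X B G)) (\<Psi> R) =
      commutator_subgroup (homeo_subgroup X G) <#>\<^bsub>homeo_subgroup X G\<^esub> B"
    using \<Psi>_kernel [OF R] by (simp only: K_def)
  have B_eq: "(homeo_subgroup X G)\<lparr>carrier := B\<rparr> = homeo_subgroup X B"
    by simp
  show ?thesis
    using \<Psi>.abelianization_right_exact [OF sum_comm_group [OF R] B_subgroup_G onto ker]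
    unfolding B_eq by (intro conjI impI)
qed

end
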